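(* Let ${\mathbb W}^- := \{ W^- : W \in {\mathbb W}^+ \}$. Then $$ {\mathbb W}^- = \left \{ W \in {\mathbb W} :\, \int_{(0,\infty)} \lambda^{-n} \,d \sigma^\ast (\lambda) < \infty \ \text{ for every } n =1,2,3,\ldots \right \}, $$ where, for $W \in {\mathbb W}$, $\sigma^\ast$ denotes the principal spectral function of the dual function $W^\ast$.
   Context: ${\mathbb W}$ is the set of all functions $W$ on ${\mathbb C}\setminus[0,\infty)$ of the form $$ W(z) = c + \int_{[0,\infty)} \frac{d \sigma (\lambda)}{\lambda-z} = c + \frac{s}{-z} + \int_{(0,\infty)} \frac{d\sigma(\lambda)}{\lambda - z}, $$ where $c \ge 0$, $\sigma$ is a right-continuous non-decreasing function with support in $[0,\infty)$ (identified with the measure $d\sigma$ on $[0,\infty)$) such that $\int_{[0,\infty)} \frac{d\sigma(\lambda)}{1+\lambda} < \infty$, and $s = \sigma(0)$ is the mass of $d\sigma$ at $0$. The function $\sigma$ is called the principal spectral function of $W$; $c$ and $\sigma$ are uniquely determined by $W$. The degenerate function $W\equiv\infty$ (that is, $c=\infty$, $\sigma = 0$) is also included in ${\mathbb W}$. The dual of $W \in {\mathbb W}$ is $$ W^\ast(z) := \frac{1}{-z\,W(z)}, $$ with the convention that the functions $\equiv 0$ and $\equiv\infty$ are dual to each other. It is a known fact that $W^\ast \in {\mathbb W}$; write $c^\ast,s^\ast,\sigma^\ast$ for the corresponding data of $W^\ast$. For $W\in{\mathbb W}$, define $$ W^-(z) := \frac{1}{-z}\, W^\ast\!\left(\frac1z\right),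 \qquad z \in {\mathbb C}\setminus[0,\infty) $$ (so $0$ and $\infty$ are also exchanged by $W \mapsto W^-$). Finally, $$ {\mathbb W}^+ := \left\{ W \in {\mathbb W} : \int_{(0,\infty)} \lambda^n\, d\sigma(\lambda) < \infty \ \text{ for every } n = 0,1,2,\ldots\right\}. $$ *)

theory Defs
  imports "HOL-Analysis.Analysis"
begin

text \<open>
  A function on \<open>\<complex> \<setminus> [0,\<infinity>)\<close> is a value \<open>Some f\<close> with \<open>f\<close> restricted to that domain (in
  the sense of \<open>restrict\<close>, so that equal functions are equal HOL terms); \<open>None\<close> is the
  degenerate function \<open>W \<equiv> \<infinity>\<close>.
\<close>

type_synonym slit_fun = "(complex \<Rightarrow> complex) option"

abbreviation slit_plane :: "complex set" where
  "slit_plane \<equiv> - \<real>\<^sub>\<ge>\<^sub>0"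

text \<open>
  Since \<open>\<sigma>\<close> vanishes on the negative half-line, \<open>interval_measure \<sigma>\<close> is concentrated on
  \<open>[0,\<infinity>)\<close> and its mass at \<open>0\<close> is \<open>\<sigma> 0\<close>.
\<close>

definition spectral_function :: "(real \<Rightarrow> real) \<Rightarrow> bool" where
  "spectral_function \<sigma> \<longleftrightarrow>
     mono \<sigma> \<and> (\<forall>x. continuous (at_right x) \<sigma>) \<and> (\<forall>x<0. \<sigma> x = 0) \<and>
     (\<integral>\<^sup>+x\<in>{0..}. ennreal (1 / (1 + x)) \<partial>interval_measure \<sigma>) < \<infinity>"

definition represents :: "ennreal \<Rightarrow> (real \<Rightarrow> real) \<Rightarrow> slit_fun \<Rightarrow> bool" where
  "represents c \<sigma> W \<longleftrightarrow>
     (case W of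
        None \<Rightarrow> c = \<infinity> \<and> \<sigma> = (\<lambda>_. 0)
      | Some f \<Rightarrow>
          c < \<infinity> \<and> spectral_function \<sigma> \<and>
          f = (\<lambda>z\<in>slit_plane. complex_of_real (enn2real c) +
                 (LINT x:{0..}|interval_measure \<sigma>. 1 / (complex_of_real x - z))))"

definition WW :: "slit_fun set" where
  "WW = {W. \<exists>c \<sigma>. represents c \<sigma> W}"

definition principal_spectral_function :: "slit_fun \<Rightarrow> real \<Rightarrow> real" where
  "principal_spectral_function W = (THE \<sigma>. \<exists>c. represents c \<sigma> W)"

definition dual :: "slit_fun \<Rightarrow> slit_fun" where
  "dual W =
     (case W of
        None \<Rightarrow> Some (\<lambda>z\<in>slit_plane. 0)
      | Some f \<Rightarrow>
          if f = (\<lambda>z\<in>slit_plane. 0) then None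
          else Some (\<lambda>z\<in>slit_plane. 1 / (- z * f z)))"

text \<open>The transform \<open>W\<^sup>-\<close>; note that \<open>z \<mapsto> 1 / z\<close> maps the domain to itself.\<close>

definition minus_transform :: "slit_fun \<Rightarrow> slit_fun" where
  "minus_transform W =
     map_option (\<lambda>g. \<lambda>z\<in>slit_plane. 1 / (- z) * g (1 / z)) (dual W)"

definition WW_plus :: "slit_fun set" where
  "WW_plus =
     {W \<in> WW. \<forall>n::nat.
        (\<integral>\<^sup>+x\<in>{0<..}. ennreal (x ^ n) \<partial>interval_measure (principal_spectral_function W)) < \<infinity>}"

definition WW_minus :: "slit_fun set" where
  "WW_minus = {minus_transform W | W. W \<in> WW_plus}"

end

theory Submission
  imports Defs "HOL-Probability.Levy" "HOL-Real_Asymp.Real_Asymp"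
begin

text \<open>
  The substitution \<open>t = 1 / (1 + \<lambda>)\<close> turns the pair \<open>(c, \<sigma>)\<close> into one finite measure \<open>\<mu>\<close> on the
  compact interval \<open>[0,1]\<close>: the measure \<open>d\<sigma>(\<lambda>) / (1 + \<lambda>)\<close> is carried over to \<open>(0,1]\<close>, and \<open>c\<close>
  becomes the mass at \<open>t = 0\<close>, that is, at \<open>\<lambda> = \<infinity>\<close>. In these terms
  \<open>W(z) = \<integral> d\<mu>(t) / ((1 - t) - t z)\<close>, and every finite measure on \<open>[0,1]\<close> occurs exactly once
  (\<open>represents_Some_iff\<close>, with injectivity from \<open>transform_inj\<close>).

  On this side the transform \<open>W(z) \<mapsto> (-1/z) W(1/z)\<close> is the reflection \<open>t \<mapsto> 1 - t\<close>
  (\<open>transform_reflect\<close>), since \<open>\<lambda> \<mapsto> 1/\<lambda>\<close> corresponds to \<open>t \<mapsto> 1 - t\<close>. Call \<open>\<mu>\<close> and \<open>\<nu>\<close> a dual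
  pair if their functions \<open>V\<close>, \<open>W\<close> satisfy \<open>- z V(z) W(z) = 1\<close>; reflecting both measures gives a
  dual pair again. So if \<open>W\<close> belongs to \<open>\<mu>\<close> and \<open>W\<^sup>*\<close> to \<open>\<nu>\<close>, then \<open>W\<^sup>-\<close> belongs to the reflection
  of \<open>\<nu>\<close>, and the dual of \<open>W\<^sup>-\<close> to the reflection of \<open>\<mu>\<close>. On \<open>(0,\<infinity>)\<close> the spectral measure of the
  latter is the image of \<open>d\<sigma>(\<lambda>) / \<lambda>\<close> under \<open>\<lambda> \<mapsto> 1/\<lambda>\<close>, so that its moment of order \<open>-(n+1)\<close> is the
  moment of order \<open>n\<close> of \<open>\<sigma>\<close> (\<open>moment_reflect\<close>). Both inclusions follow, because \<open>W \<mapsto> W\<^sup>-\<close> is an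
  involution: reflecting and dualizing commute, and each of them undoes itself.

  The substance is that every nonzero measure has a dual one (\<open>exists_dual_pair\<close>). For a measure with finitely many
  atoms inside \<open>(0,1)\<close> the function is rational; its zeros separate its poles, and the sign pattern of
  the interlacing zeros and poles makes all partial fraction coefficients of the dual function
  nonnegative (\<open>discrete_dual\<close>). A general measure is approximated by such discrete ones
  (\<open>grid_sum_tendsto_transform\<close>). The dual measures live on the compact interval \<open>[0,1]\<close> and their
  total masses converge, so Helly's theorem provides a limit measure (\<open>unit_measure_compactness\<close>),
  and the duality equation passes to the limit.
\<close>

section \<open>Rational functions with interlacing zeros and poles\<close>

text \<open>
  A polynomial cannot have more roots than its degree, so once all factors \<open>x - a\<close> are split off only a
  constant remains.
\<close>

lemma poly_split_off_roots:
  fixes p :: "'a::field poly"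
  assumes "finite A" "\<And>a. a \<in> A \<Longrightarrow> poly p a = 0" "degree p \<le> card A"
  shows "\<exists>K. \<forall>x. poly p x = K * (\<Prod>a\<in>A. x - a)"
  using assms
proof (induction A arbitrary: p rule: finite_induct)
  case empty
  then obtain K where "p = [:K:]" by (auto elim: degree_eq_zeroE)
  then show ?case by auto
next
  case (insert b A)
  from insert.prems(1)[of b] obtain q where q: "p = [:-b, 1:] * q"
    by (auto simp: poly_eq_0_iff_dvd)
  have "poly q a = 0" if "a \<in> A" for a
    using insert.prems(1)[of a] that insert.hyps q by auto
  moreover have "degree q \<le> card A"
    using insert.prems(2) insert.hyps q by (cases "q = 0") (auto simp del: mult_pCons_left simp: degree_mult_eq)
  ultimately obtain K where "\<forall>x. poly q x = K * (\<Prod>a\<in>A. x - a)"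
    using insert.IH by blast
  moreover have "poly p x = (x - b) * poly q x" for x
    unfolding q poly_mult by simp
  ultimately show ?case
    using insert.hyps by (auto intro!: exI[of _ K])
qed

lemma degree_prod_linear_le:
  fixes f :: "'b \<Rightarrow> 'a::idom"
  assumes "finite A"
  shows "degree (\<Prod>k\<in>A. [:- f k, 1:]) \<le> card A"
proof -
  have "degree (\<Prod>k\<in>A. [:- f k, 1:]) \<le> (\<Sum>k\<in>A. degree [:- f k, 1:])"
    using degree_prod_sum_le[OF assms, of "\<lambda>k. [:- f k, 1:]"] unfolding o_def .
  also have "\<dots> = card A" by simp
  finally show ?thesis .
qed

lemma Lagrange_interpolation:
  fixes p :: "'a::field poly"
  assumes inj: "inj_on u {..n}" and deg: "degree p \<le> n"
  shows "poly p x = (\<Sum>j\<le>n. poly p (u j) / (\<Prod>k\<in>{..n}-{j}. u j - u k) * (\<Prod>k\<in>{..n}-{j}. x - u k))"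
proof -
  define q where "q = (\<Sum>j\<le>n. smult (poly p (u j) / (\<Prod>k\<in>{..n}-{j}. u j - u k)) (\<Prod>k\<in>{..n}-{j}. [:-u k, 1:]))"
  have poly_q: "poly q y = (\<Sum>j\<le>n. poly p (u j) / (\<Prod>k\<in>{..n}-{j}. u j - u k) * (\<Prod>k\<in>{..n}-{j}. y - u k))" for y
    by (simp add: q_def poly_sum poly_prod)
  have deg_q: "degree q \<le> n"
    unfolding q_def
  proof (rule degree_sum_le)
    fix j assume "j \<in> {..n}"
    then show "degree (smult (poly p (u j) / (\<Prod>k\<in>{..n}-{j}. u j - u k)) (\<Prod>k\<in>{..n}-{j}. [:-u k, 1:])) \<le> n"
      using degree_prod_linear_le[of "{..n}-{j}" u] by (intro order_trans[OF degree_smult_le]) auto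
  qed simp
  have "poly p (u i) = poly q (u i)" if i: "i \<le> n" for i
  proof -
    have "poly q (u i) = (\<Sum>j\<in>{i}. poly p (u j) / (\<Prod>k\<in>{..n}-{j}. u j - u k) * (\<Prod>k\<in>{..n}-{j}. u i - u k))"
      unfolding poly_q using i by (intro sum.mono_neutral_right) (auto intro!: prod_zero)
    moreover have "(\<Prod>k\<in>{..n}-{i}. u i - u k) \<noteq> 0"
      using inj i by (auto simp: inj_on_def)
    ultimately show ?thesis by simp
  qed
  then have "p = q"
    using deg deg_q inj by (intro poly_eqI_degree[of "u ` {..n}"]) (auto simp: card_image)
  then have "poly p x = poly q x" by simp
  then show ?thesis by (rule trans[OF _ poly_q])
qed

text \<open>
  The Cauchy kernel \<open>(1 + \<lambda>) / (\<lambda> - z)\<close> in the coordinate \<open>t = 1 / (1 + \<lambda>)\<close>; at \<open>t = 0\<close>, the point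
  \<open>\<lambda> = \<infinity>\<close>, it has the value \<open>1\<close>, as needed for the constant \<open>c\<close>.
\<close>

definition kernel :: "complex \<Rightarrow> real \<Rightarrow> complex" where
  "kernel z t = 1 / (of_real (1 - t) - of_real t * z)"

lemma kernel_denominator_nonzero:
  assumes "z \<in> slit_plane" "0 \<le> t" "t \<le> 1"
  shows "of_real (1 - t) - of_real t * z \<noteq> 0"
proof
  assume eq: "of_real (1 - t) - of_real t * z = 0"
  with assms have "t \<noteq> 0" by auto
  with eq have "z = of_real ((1 - t) / t)" by (simp add: field_simps)
  then have "z \<in> \<real>\<^sub>\<ge>\<^sub>0"
    using assms by (simp only: nonneg_Reals_of_real_iff) simp
  with assms show False by simp
qed

text \<open>
  The sum is the numerator of \<open>\<Sum>i. m i / (x - t i)\<close>. At a node only one summand survives, and at two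
  neighbouring nodes the surviving values have opposite signs, so the intermediate value theorem gives
  a root strictly between them.
\<close>

lemma interlacing_roots:
  fixes t m :: "nat \<Rightarrow> real"
  assumes incr: "\<And>i k. i < k \<Longrightarrow> k < n \<Longrightarrow> t i < t k"
    and pos: "\<And>i. i < n \<Longrightarrow> 0 < m i"
    and j: "0 < j" "j < n"
  shows "\<exists>x. t (j - 1) < x \<and> x < t j \<and> (\<Sum>i<n. m i * (\<Prod>k\<in>{..<n}-{i}. x - t k)) = 0"
proof -
  define Q where "Q x = (\<Sum>i<n. m i * (\<Prod>k\<in>{..<n}-{i}. x - t k))" for x
  have Q_node: "Q (t i) = m i * (\<Prod>k\<in>{..<n}-{i}. t i - t k)" if "i < n" for i
  proof -
    have "Q (t i) = (\<Sum>l\<in>{i}. m l * (\<Prod>k\<in>{..<n}-{l}. t i - t k))"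
      unfolding Q_def using that by (intro sum.mono_neutral_right) (auto intro!: prod_zero)
    then show ?thesis by simp
  qed
  let ?R = "{..<n} - {j-1, j}"
  have split1: "{..<n}-{j-1} = insert j ?R" and split2: "{..<n}-{j} = insert (j-1) ?R"
    using j by auto
  have "j - 1 < n" using j by simp
  have "Q (t (j-1)) * Q (t j) =
      m (j-1) * m j * ((t (j-1) - t j) * (t j - t (j-1))) * (\<Prod>k\<in>?R. (t (j-1) - t k) * (t j - t k))"
    unfolding Q_node[OF \<open>j - 1 < n\<close>] Q_node[OF j(2)] split1 split2
    using j by (simp only: prod.insert finite_Diff finite_lessThan prod.distrib) (simp add: algebra_simps)
  moreover have "(\<Prod>k\<in>?R. (t (j-1) - t k) * (t j - t k)) > 0"
  proof (intro prod_pos ballI)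
    fix k assume k: "k \<in> ?R"
    show "(t (j-1) - t k) * (t j - t k) > 0"
    proof (cases "k < j")
      case True
      then show ?thesis using k j incr[of k "j-1"] incr[of k j] by (auto intro!: mult_pos_pos)
    next
      case False
      then show ?thesis using k j incr[of "j-1" k] incr[of j k] by (auto intro!: mult_neg_neg)
    qed
  qed
  moreover have "(t (j-1) - t j) * (t j - t (j-1)) < 0"
    using incr[of "j-1" j] j by (auto intro!: mult_neg_pos)
  ultimately have neg: "Q (t (j-1)) * Q (t j) < 0"
    using pos[of j] pos[of "j-1"] j by (auto simp: mult_less_0_iff zero_less_mult_iff)
  have lt: "t (j-1) < t j" using incr[of "j-1" j] j by auto
  have cont: "continuous_on {t (j-1)..t j} Q"
    unfolding Q_def by (intro continuous_intros)
  have "\<exists>x. t (j-1) \<le> x \<and> x \<le> t j \<and> Q x = 0"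
  proof (cases "Q (t (j-1)) < 0")
    case True
    then show ?thesis using neg lt cont IVT'[of Q "t (j-1)" 0 "t j"] by (auto simp: mult_less_0_iff)
  next
    case False
    then show ?thesis using neg lt cont IVT2'[of Q "t j" 0 "t (j-1)"] by (auto simp: mult_less_0_iff)
  qed
  then obtain x where x: "t (j-1) \<le> x" "x \<le> t j" "Q x = 0" by auto
  with neg have "x \<noteq> t (j-1)" "x \<noteq> t j" by auto
  with x show ?thesis unfolding Q_def by (intro exI[of _ x]) auto
qed

text \<open>
  In the coordinate \<open>y = 1 / (1 + z)\<close> the function of the discrete measure is \<open>y Q(y) / P(y)\<close> with
  \<open>P(y) = \<Prod>i. (y - t i)\<close>. The nodes \<open>u\<close> of the dual measure are \<open>0\<close>, \<open>1\<close> and the roots of \<open>Q\<close>. They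
  interlace with the nodes \<open>t\<close>, and its weights are, up to a positive constant, the Lagrange coefficients
  of \<open>P\<close> at the nodes \<open>u\<close>; interlacing makes these positive.
\<close>

lemma discrete_dual:
  fixes t m :: "nat \<Rightarrow> real"
  assumes n: "0 < n"
    and incr: "\<And>i k. i < k \<Longrightarrow> k < n \<Longrightarrow> t i < t k"
    and t01: "\<And>i. i < n \<Longrightarrow> 0 < t i \<and> t i < 1"
    and pos: "\<And>i. i < n \<Longrightarrow> 0 < m i"
  obtains u q :: "nat \<Rightarrow> real" where
    "\<And>j. j \<le> n \<Longrightarrow> 0 \<le> u j \<and> u j \<le> 1" "\<And>j. j \<le> n \<Longrightarrow> 0 \<le> q j"
    "\<And>z. z \<in> slit_plane \<Longrightarrow>
       - z * (\<Sum>i<n. m i * kernel z (t i)) * (\<Sum>j\<le>n. q j * kernel z (u j)) = 1"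
proof -
  have "\<forall>j\<in>{0<..<n}. \<exists>x. t (j - 1) < x \<and> x < t j \<and> (\<Sum>i<n. m i * (\<Prod>k\<in>{..<n}-{i}. x - t k)) = 0"
    using interlacing_roots[of n t m] incr pos by auto
  from bchoice[OF this] obtain v where "\<forall>j\<in>{0<..<n}. t (j - 1) < v j \<and> v j < t j \<and>
      (\<Sum>i<n. m i * (\<Prod>k\<in>{..<n}-{i}. v j - t k)) = 0"
    by blast
  then have v: "t (j - 1) < v j \<and> v j < t j \<and> (\<Sum>i<n. m i * (\<Prod>k\<in>{..<n}-{i}. v j - t k)) = 0"
    if "0 < j" "j < n" for j
    using that by auto
  define u where "u j = (if j = 0 then 0 else if j = n then 1 else v j)" for j
  have tu: "t i < u j" if "i < j" "j \<le> n" for i j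
  proof (cases "j = n")
    case True
    then show ?thesis using t01[of i] that n by (simp add: u_def)
  next
    case False
    then have "t i \<le> t (j - 1)" using incr[of i "j-1"] that by (cases "i = j - 1") force+
    then show ?thesis using v[of j] that False by (simp add: u_def)
  qed
  have ut: "u j < t i" if "j \<le> i" "i < n" for i j
  proof (cases "j = 0")
    case True
    then show ?thesis using t01[of i] that by (simp add: u_def)
  next
    case False
    then have "t j \<le> t i" using incr[of j i] that by (cases "i = j") force+
    then show ?thesis using v[of j] that False by (simp add: u_def)
  qed
  have u_incr: "u j < u k" if "j < k" "k \<le> n" for j k
    using ut[of j j] tu[of j k] that by auto
  have u01: "0 \<le> u j \<and> u j \<le> 1" if "j \<le> n" for j
    using u_incr[of 0 j] u_incr[of j n] that n by (cases "j = 0"; cases "j = n") (auto simp: u_def)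
  define r where "r j = (\<Prod>i<n. u j - t i) / (\<Prod>k\<in>{..n}-{j}. u j - u k)" for j
  \<comment> \<open>Pair the \<open>n\<close> factors of the numerator with those of the denominator: \<open>t i\<close> with \<open>u i\<close> to the left
    of \<open>u j\<close>, and \<open>t i\<close> with \<open>u (i + 1)\<close> to the right. By interlacing each quotient is positive.\<close>
  have r_pos: "0 < r j" if j: "j \<le> n" for j
  proof -
    have A: "(\<Prod>i<n. u j - t i) = (\<Prod>i<j. u j - t i) * (\<Prod>i\<in>{j..<n}. u j - t i)"
      using j by (subst prod.union_disjoint[symmetric]) (auto intro!: prod.cong)
    have B: "(\<Prod>k\<in>{..n}-{j}. u j - u k) = (\<Prod>k<j. u j - u k) * (\<Prod>k\<in>{Suc j..<Suc n}. u j - u k)"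
      using j by (subst prod.union_disjoint[symmetric]) (auto intro!: prod.cong)
    have C: "(\<Prod>k\<in>{Suc j..<Suc n}. u j - u k) = (\<Prod>k\<in>{j..<n}. u j - u (Suc k))"
      by (rule prod.shift_bounds_Suc_ivl)
    have "r j = (\<Prod>i<j. (u j - t i) / (u j - u i)) * (\<Prod>i\<in>{j..<n}. (u j - t i) / (u j - u (Suc i)))"
      unfolding r_def A B C by (simp add: prod_dividef)
    also have "\<dots> > 0"
      using j tu[of _ j] u_incr[of _ j] ut[of j] u_incr[of j]
      by (intro mult_pos_pos prod_pos ballI) (auto intro!: divide_pos_pos divide_neg_neg)
    finally show ?thesis .
  qed
  let ?u = "\<lambda>j. complex_of_real (u j)"
  have u_eq: "u j = u k \<longleftrightarrow> j = k" if "j \<le> n" "k \<le> n" for j k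
    using u_incr[of j k] u_incr[of k j] that by (cases j k rule: linorder_cases) auto
  have inj: "inj_on ?u {..n}" using u_eq by (auto simp: inj_on_def)
  define Q where "Q = (\<Sum>i<n. smult (complex_of_real (m i)) (\<Prod>k\<in>{..<n}-{i}. [:- of_real (t k), 1:]))"
  define P where "P = (\<Prod>i<n. [:- complex_of_real (t i), 1:])"
  have poly_Q: "poly Q y = (\<Sum>i<n. of_real (m i) * (\<Prod>k\<in>{..<n}-{i}. y - of_real (t k)))" for y
    by (simp add: Q_def poly_sum poly_prod)
  have poly_P: "poly P y = (\<Prod>i<n. y - of_real (t i))" for y
    by (simp add: P_def poly_prod)
  have deg_P: "degree P \<le> n"
    using degree_prod_linear_le[of "{..<n}" "\<lambda>i. complex_of_real (t i)"] by (simp add: P_def)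
  have deg_Q: "degree Q \<le> n - 1"
    unfolding Q_def
  proof (rule degree_sum_le)
    fix i assume "i \<in> {..<n}"
    then show "degree (smult (complex_of_real (m i)) (\<Prod>k\<in>{..<n}-{i}. [:- of_real (t k), 1:])) \<le> n - 1"
      using degree_prod_linear_le[of "{..<n}-{i}" "\<lambda>i. complex_of_real (t i)"]
      by (intro order_trans[OF degree_smult_le]) auto
  qed simp
  have "\<exists>K. \<forall>x. poly ([:0, 1:] * ([:-1, 1:] * Q)) x = K * (\<Prod>a\<in>?u ` {..n}. x - a)"
  proof (rule poly_split_off_roots)
    fix a assume "a \<in> ?u ` {..n}"
    then obtain j where j: "j \<le> n" "a = ?u j" by auto
    show "poly ([:0, 1:] * ([:-1, 1:] * Q)) a = 0"
    proof (cases "j = 0 \<or> j = n")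
      case True
      then show ?thesis using j by (auto simp: u_def)
    next
      case False
      have "poly Q a = of_real (\<Sum>i<n. m i * (\<Prod>k\<in>{..<n}-{i}. v j - t k))"
        unfolding poly_Q j using False by (simp add: u_def)
      also have "\<dots> = 0" using v[of j] False j by simp
      finally show ?thesis by simp
    qed
  next
    have "degree ([:0, 1:] * ([:-1, 1:] * Q)) \<le> 1 + (1 + (n - 1))"
      using deg_Q by (intro order_trans[OF degree_mult_le] add_mono) auto
    then show "degree ([:0, 1:] * ([:-1, 1:] * Q)) \<le> card (?u ` {..n})"
      using inj n by (simp add: card_image del: mult_pCons_left)
  qed simp
  then obtain K where "\<And>x. poly ([:0, 1:] * ([:-1, 1:] * Q)) x = K * (\<Prod>a\<in>?u ` {..n}. x - a)"
    by blast
  then have K: "x * ((x - 1) * poly Q x) = K * (\<Prod>j\<le>n. x - ?u j)" for x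
    by (simp add: prod.reindex[OF inj] algebra_simps)
  define A where "A z = (\<Sum>i<n. m i * kernel z (t i))" for z
  define B where "B z = (\<Sum>j\<le>n. r j * kernel z (u j))" for z
  \<comment> \<open>The point \<open>z = -1\<close> corresponds to \<open>y = \<infinity>\<close> and is recovered below by continuity.\<close>
  have const: "- z * A z * B z = K" if z: "z \<in> slit_plane" "z \<noteq> -1" for z
  proof -
    define y where "y = 1 / (1 + z)"
    have "1 + z \<noteq> 0" using z(2) by (metis add.inverse_unique)
    then have y0: "y \<noteq> 0" and zy: "z = (1 - y) / y" by (auto simp: y_def field_simps)
    have y_neq: "y \<noteq> of_real s" and ker: "kernel z s = y / (y - of_real s)" if "0 \<le> s" "s \<le> 1" for s
    proof -
      have eq: "of_real (1 - s) - of_real s * z = (y - of_real s) / y"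
        using y0 by (simp add: zy field_simps)
      show "y \<noteq> of_real s" using kernel_denominator_nonzero[OF z(1) that] eq by auto
      show "kernel z s = y / (y - of_real s)" unfolding kernel_def eq by simp
    qed
    have P0: "poly P y \<noteq> 0" unfolding poly_P using y_neq t01 by (auto simp: less_imp_le)
    have R0: "(\<Prod>j\<le>n. y - ?u j) \<noteq> 0" using y_neq u01 by (auto simp: less_imp_le)
    have "A z = y * (poly Q y / poly P y)"
      unfolding A_def poly_Q sum_divide_distrib sum_distrib_left
    proof (rule sum.cong)
      fix i assume i: "i \<in> {..<n}"
      have "poly P y = (y - of_real (t i)) * (\<Prod>k\<in>{..<n}-{i}. y - of_real (t k))"
        unfolding poly_P using i by (subst prod.remove[of _ i]) auto
      then show "of_real (m i) * kernel z (t i) =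
          y * (of_real (m i) * (\<Prod>k\<in>{..<n}-{i}. y - of_real (t k)) / poly P y)"
        using ker[of "t i"] t01[of i] i P0 by (auto simp: less_imp_le)
    qed simp
    moreover have "B z = y * (poly P y / (\<Prod>j\<le>n. y - ?u j))"
    proof -
      have "B z = y * ((\<Sum>j\<le>n. of_real (r j) * (\<Prod>k\<in>{..n}-{j}. y - ?u k)) / (\<Prod>j\<le>n. y - ?u j))"
        unfolding B_def sum_divide_distrib sum_distrib_left
      proof (rule sum.cong)
        fix j assume j: "j \<in> {..n}"
        have "(\<Prod>k\<le>n. y - ?u k) = (y - ?u j) * (\<Prod>k\<in>{..n}-{j}. y - ?u k)"
          using j by (subst prod.remove[of _ j]) auto
        then show "of_real (r j) * kernel z (u j) =
            y * (of_real (r j) * (\<Prod>k\<in>{..n}-{j}. y - ?u k) / (\<Prod>k\<le>n. y - ?u k))"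
          using ker[of "u j"] u01[of j] j R0 by auto
      qed simp
      also have "(\<Sum>j\<le>n. of_real (r j) * (\<Prod>k\<in>{..n}-{j}. y - ?u k)) = poly P y"
        unfolding Lagrange_interpolation[OF inj deg_P, of y] by (simp add: r_def poly_P)
      finally show ?thesis .
    qed
    ultimately have "- z * A z * B z =
        - z * (y * (poly Q y / poly P y)) * (y * (poly P y / (\<Prod>j\<le>n. y - ?u j)))"
      by (simp only:)
    also have "\<dots> = (- z * y) * (y * poly Q y) / (\<Prod>j\<le>n. y - ?u j)"
      using P0 by simp
    also have "- z * y = y - 1" using y0 by (simp add: zy)
    finally have "- z * A z * B z = y * ((y - 1) * poly Q y) / (\<Prod>j\<le>n. y - ?u j)"
      by (simp add: mult_ac)
    then show ?thesis using K[of y] R0 by simp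
  qed
  have at_m1: "- (-1) * A (-1) * B (-1) = K"
  proof (rule LIM_unique)
    have "isCont (\<lambda>z. - z * A z * B z) (-1)"
      unfolding A_def B_def kernel_def
      by (intro continuous_intros) (auto simp: algebra_simps)
    then show "(\<lambda>z. - z * A z * B z) \<midarrow>-1\<rightarrow> - (-1) * A (-1) * B (-1)"
      by (simp add: isCont_def)
    have "open slit_plane" by (auto intro: closed_nonneg_Reals_complex)
    moreover have "-1 \<in> slit_plane" by auto
    ultimately have "eventually (\<lambda>z. z \<in> slit_plane) (at (-1))"
      by (rule eventually_at_in_open')
    then have "eventually (\<lambda>z. - z * A z * B z = K) (at (-1))"
      using eventually_neq_at_within[of "-1"] by eventually_elim (use const in auto)
    then show "(\<lambda>z. - z * A z * B z) \<midarrow>-1\<rightarrow> K" by (rule tendsto_eventually)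
  qed
  \<comment> \<open>Every kernel has the value \<open>1\<close> at \<open>z = -1\<close>, which identifies \<open>K\<close> and shows that it is positive.\<close>
  define k where "k = (\<Sum>i<n. m i) * (\<Sum>j\<le>n. r j)"
  have "K = of_real k"
    using at_m1 by (simp add: A_def B_def kernel_def k_def)
  have "k > 0" unfolding k_def using pos r_pos n by (intro mult_pos_pos sum_pos) auto
  show ?thesis
  proof (rule that)
    show "0 \<le> u j \<and> u j \<le> 1" if "j \<le> n" for j using u01 that .
    show "0 \<le> r j / k" if "j \<le> n" for j using r_pos[OF that] \<open>k > 0\<close> by simp
    show "- z * (\<Sum>i<n. m i * kernel z (t i)) * (\<Sum>j\<le>n. of_real (r j / k) * kernel z (u j)) = 1"
      if z: "z \<in> slit_plane" for z
    proof -
      have "- z * A z * B z = K" using at_m1 const[OF z] by (cases "z = -1") auto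
      moreover have "(\<Sum>j\<le>n. of_real (r j / k) * kernel z (u j)) = B z / K"
        unfolding B_def sum_divide_distrib \<open>K = of_real k\<close> by (rule sum.cong) auto
      ultimately show ?thesis using \<open>k > 0\<close> \<open>K = of_real k\<close> by (simp add: A_def)
    qed
  qed
qed

section \<open>Measures on the unit interval and their compactness\<close>

lemma kernel_minus_one [simp]: "kernel (-1) t = 1"
  by (simp add: kernel_def)

lemma measurable_kernel [measurable]: "kernel z \<in> borel_measurable borel"
  unfolding kernel_def by measurable

lemma continuous_on_kernel: "z \<in> slit_plane \<Longrightarrow> continuous_on {0..1} (kernel z)"
  unfolding kernel_def using kernel_denominator_nonzero[of z]
  by (intro continuous_intros) auto

lemma kernel_bounded:
  assumes "z \<in> slit_plane"
  obtains B where "\<And>t. 0 \<le> t \<Longrightarrow> t \<le> 1 \<Longrightarrow> norm (kernel z t) \<le> B"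
proof -
  have "bounded (kernel z ` {0..1})"
    by (intro compact_imp_bounded compact_continuous_image continuous_on_kernel assms compact_Icc)
  then show ?thesis using that by (fastforce simp: bounded_iff)
qed

text \<open>
  Weak convergence is tested against continuous functions on the whole line. Composition with \<open>clamp\<close>
  extends the kernel continuously from \<open>[0,1]\<close>.
\<close>

definition clamp :: "real \<Rightarrow> real" where "clamp t = max 0 (min 1 t)"

lemma clamp_range: "0 \<le> clamp t" "clamp t \<le> 1"
  by (auto simp: clamp_def)

lemma clamp_eq: "0 \<le> t \<Longrightarrow> t \<le> 1 \<Longrightarrow> clamp t = t"
  by (simp add: clamp_def)

lemma isCont_kernel_clamp:
  assumes "z \<in> slit_plane" shows "isCont (\<lambda>t. kernel z (clamp t)) t"
proof -
  have "continuous_on UNIV (\<lambda>t. kernel z (clamp t))"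
    by (rule continuous_on_compose2[OF continuous_on_kernel[OF assms]])
       (auto simp: clamp_range clamp_def intro!: continuous_intros)
  then show ?thesis by (simp add: continuous_on_eq_continuous_at)
qed

definition transform :: "real measure \<Rightarrow> complex \<Rightarrow> complex" where
  "transform \<mu> z = (LINT t|\<mu>. kernel z t)"

text \<open>
  "Unit" refers to the interval \<open>[0,1]\<close> that carries the measure; the total mass is arbitrary.
\<close>

locale unit_measure = finite_measure \<mu> for \<mu> :: "real measure" +
  assumes sets_eq_borel [simp, measurable_cong]: "sets \<mu> = sets borel"
    and unit_supported: "AE t in \<mu>. 0 \<le> t \<and> t \<le> 1"
begin

lemma space_eq_UNIV [simp]: "space \<mu> = UNIV"
  using sets_eq_imp_space_eq[OF sets_eq_borel] by simp

lemma integrable_bounded_on_unit: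
  fixes f :: "real \<Rightarrow> 'b::{banach, second_countable_topology}"
  assumes "f \<in> borel_measurable borel" "\<And>t. 0 \<le> t \<Longrightarrow> t \<le> 1 \<Longrightarrow> norm (f t) \<le> B"
  shows "integrable \<mu> f"
proof (rule integrable_const_bound)
  show "AE t in \<mu>. norm (f t) \<le> B"
    using unit_supported by eventually_elim (use assms(2) in auto)
  show "f \<in> borel_measurable \<mu>" using assms(1) by simp
qed

lemma integrable_kernel: "z \<in> slit_plane \<Longrightarrow> integrable \<mu> (kernel z)"
  using kernel_bounded[of z] integrable_bounded_on_unit[of "kernel z"] by (metis measurable_kernel)

lemma transform_minus_one: "transform \<mu> (-1) = of_real (measure \<mu> UNIV)"
  by (simp add: transform_def scaleR_conv_of_real)

lemma density_const_unit:
  assumes "0 \<le> c"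
  shows "unit_measure (density \<mu> (\<lambda>_. ennreal c))"
    and "transform (density \<mu> (\<lambda>_. ennreal c)) z = of_real c * transform \<mu> z"
proof -
  show "unit_measure (density \<mu> (\<lambda>_. ennreal c))"
  proof (intro unit_measure.intro unit_measure_axioms.intro finite_measureI)
    show "emeasure (density \<mu> (\<lambda>_. ennreal c)) (space (density \<mu> (\<lambda>_. ennreal c))) \<noteq> \<infinity>"
      by (simp add: emeasure_density ennreal_mult_eq_top_iff emeasure_eq_measure)
    show "AE t in density \<mu> (\<lambda>_. ennreal c). 0 \<le> t \<and> t \<le> 1"
      using unit_supported by (subst AE_density) auto
  qed simp
  show "transform (density \<mu> (\<lambda>_. ennreal c)) z = of_real c * transform \<mu> z"
    unfolding transform_def using assms
    by (subst integral_density) (auto simp: scaleR_conv_of_real)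
qed

end

text \<open>
  Helly's selection theorem applies because all measures live on one compact interval. The limit does
  so as well, since the continuous function \<open>d\<close>, which vanishes exactly on \<open>[0,1]\<close>, has integral \<open>0\<close>
  with respect to all members of the sequence.
\<close>

lemma unit_measure_compactness:
  fixes \<mu> :: "nat \<Rightarrow> real measure"
  assumes unit: "\<And>n. unit_measure (\<mu> n)" and prob: "\<And>n. prob_space (\<mu> n)"
  obtains r \<nu> where "strict_mono r" "unit_measure \<nu>"
    "\<And>z. z \<in> slit_plane \<Longrightarrow> (\<lambda>n. transform (\<mu> (r n)) z) \<longlonglongrightarrow> transform \<nu> z"
proof -
  have real_distr: "real_distribution (\<mu> n)" for n
    using unit[of n] prob[of n]
    by (simp add: real_distribution_def real_distribution_axioms_def unit_measure_def unit_measure_axioms_def)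
  have "tight \<mu>"
    unfolding tight_def
  proof (intro conjI allI impI)
    fix \<epsilon> :: real assume "0 < \<epsilon>"
    have "measure (\<mu> n) {-1<..1} > 1 - \<epsilon>" for n
    proof -
      interpret unit_measure "\<mu> n" by fact
      interpret prob_space "\<mu> n" by fact
      have "measure (\<mu> n) {-1<..1} = 1"
      proof (rule prob_eq_1[THEN iffD2])
        show "AE t in \<mu> n. t \<in> {-1<..1}" using unit_supported by eventually_elim auto
      qed simp
      then show ?thesis using \<open>0 < \<epsilon>\<close> by simp
    qed
    then show "\<exists>a b. a < b \<and> (\<forall>n. 1 - \<epsilon> < measure (\<mu> n) {a<..b})"
      by (intro exI[of _ "-1"] exI[of _ 1]) auto
  qed (use real_distr in auto)
  from tight_imp_convergent_subsubsequence[OF this, of id]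
  obtain r \<nu> where r: "strict_mono r" and \<nu>: "real_distribution \<nu>" and "weak_conv_m (\<mu> \<circ> r) \<nu>"
    by (auto simp: strict_mono_def)
  then have conv: "(\<lambda>n. integral\<^sup>L (\<mu> (r n)) f) \<longlonglongrightarrow> integral\<^sup>L \<nu> f"
    if "\<And>x. isCont f x" "\<And>x. norm (f x) \<le> B" for f :: "real \<Rightarrow> 'b::{banach, second_countable_topology}" and B
    using weak_conv_imp_integral_bdd_continuous_conv[of "\<mu> \<circ> r" \<nu> f B] real_distr that by simp
  interpret \<nu>: real_distribution \<nu> by fact
  define d where "d = (\<lambda>t::real. min 1 \<bar>t - clamp t\<bar>)"
  have d_meas[measurable]: "d \<in> borel_measurable borel"
    unfolding d_def clamp_def by measurable
  have d_nonneg: "0 \<le> d t" for t by (simp add: d_def)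
  have "integral\<^sup>L (\<mu> (r n)) d = 0" for n
  proof -
    interpret unit_measure "\<mu> (r n)" by fact
    have "AE t in \<mu> (r n). d t = 0"
      using unit_supported by eventually_elim (auto simp: d_def clamp_eq)
    then have "integral\<^sup>L (\<mu> (r n)) d = integral\<^sup>L (\<mu> (r n)) (\<lambda>_. 0)"
      by (intro integral_cong_AE) auto
    then show ?thesis by simp
  qed
  moreover have "(\<lambda>n. integral\<^sup>L (\<mu> (r n)) d) \<longlonglongrightarrow> integral\<^sup>L \<nu> d"
    by (rule conv[of _ 1]) (auto simp: d_def clamp_def intro!: continuous_intros)
  ultimately have "integral\<^sup>L \<nu> d = 0"
    by (simp add: LIMSEQ_const_iff)
  moreover have "integrable \<nu> d"
    by (rule \<nu>.integrable_const_bound[of _ 1]) (use d_meas in \<open>auto simp: d_def\<close>)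
  ultimately have "AE t in \<nu>. d t = 0"
    using integral_nonneg_eq_0_iff_AE[of \<nu> d] by (auto simp: d_nonneg)
  then have supp: "AE t in \<nu>. 0 \<le> t \<and> t \<le> 1"
    by eventually_elim (auto simp: d_def clamp_def split: if_splits simp: min_def max_def)
  have \<nu>_unit: "unit_measure \<nu>"
    by unfold_locales (use supp in auto)
  have clamp: "transform M z = (LINT t|M. kernel z (clamp t))" if "unit_measure M" for M z
  proof -
    interpret unit_measure M by fact
    have "AE t in M. kernel z t = kernel z (clamp t)"
      using unit_supported by eventually_elim (auto simp: clamp_eq)
    moreover have "clamp \<in> borel_measurable borel" unfolding clamp_def by measurable
    ultimately show ?thesis
      unfolding transform_def by (intro integral_cong_AE) auto
  qed
  show ?thesis
  proof (rule that[OF r \<nu>_unit])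
    fix z assume z: "z \<in> slit_plane"
    obtain B where "\<And>t. 0 \<le> t \<Longrightarrow> t \<le> 1 \<Longrightarrow> norm (kernel z t) \<le> B"
      by (rule kernel_bounded[OF z]) blast
    then show "(\<lambda>n. transform (\<mu> (r n)) z) \<longlonglongrightarrow> transform \<nu> z"
      unfolding clamp[OF unit] clamp[OF \<nu>_unit]
      using isCont_kernel_clamp[OF z] clamp_range by (intro conv[of _ B]) auto
  qed
qed

lemma finite_sum_as_unit_measure:
  fixes u q :: "nat \<Rightarrow> real"
  assumes u: "\<And>j. j \<le> n \<Longrightarrow> 0 \<le> u j \<and> u j \<le> 1" and q: "\<And>j. j \<le> n \<Longrightarrow> 0 \<le> q j"
  defines "\<mu> \<equiv> distr (point_measure {..n} (\<lambda>j. ennreal (q j))) borel u"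
  shows "unit_measure \<mu>" "transform \<mu> z = (\<Sum>j\<le>n. q j * kernel z (u j))"
    "emeasure \<mu> UNIV = ennreal (\<Sum>j\<le>n. q j)"
proof -
  let ?P = "point_measure {..n} (\<lambda>j. ennreal (q j))"
  have u_meas: "u \<in> measurable ?P borel" by (simp add: measurable_point_measure_eq1)
  show mass: "emeasure \<mu> UNIV = ennreal (\<Sum>j\<le>n. q j)"
    unfolding \<mu>_def using u_meas q
    by (subst emeasure_distr) (auto simp: space_point_measure emeasure_point_measure_finite intro!: sum_ennreal)
  show "unit_measure \<mu>"
  proof (intro unit_measure.intro unit_measure_axioms.intro finite_measureI)
    show "emeasure \<mu> (space \<mu>) \<noteq> \<infinity>" using mass by (simp add: \<mu>_def)
    have "AE j in ?P. 0 \<le> u j \<and> u j \<le> 1" by (rule AE_I2) (use u in \<open>auto simp: space_point_measure\<close>)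
    then show "AE t in \<mu>. 0 \<le> t \<and> t \<le> 1"
      unfolding \<mu>_def using u_meas by (subst AE_distr_iff) auto
  qed (simp add: \<mu>_def)
  show "transform \<mu> z = (\<Sum>j\<le>n. q j * kernel z (u j))"
    unfolding transform_def \<mu>_def using u_meas q
    by (subst integral_distr, simp, simp, subst lebesgue_integral_point_measure_finite)
       (auto simp: scaleR_conv_of_real)
qed

section \<open>Approximation by discrete measures and existence of the dual measure\<close>

text \<open>
  The cells for \<open>i \<le> N\<close> cover \<open>[0,1]\<close>; for \<open>N > 0\<close> the cell with \<open>i = N\<close> meets it
  only in the point \<open>1\<close>. The nodes are moved slightly off the grid, to lie strictly inside \<open>(0,1)\<close>,
  and the extra summand \<open>1 / (N+1)\<^sup>2\<close> makes all weights positive, as \<open>discrete_dual\<close> demands. The extra mass is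
  \<open>1 / (N+1)\<close> in total, which disappears in the limit.
\<close>

definition grid_node :: "nat \<Rightarrow> nat \<Rightarrow> real" where
  "grid_node N i = (real i + 1) / (real N + 2)"

definition grid_cell :: "nat \<Rightarrow> nat \<Rightarrow> real set" where
  "grid_cell N i = {t. nat \<lfloor>real N * t\<rfloor> = i}"

definition grid_weight :: "real measure \<Rightarrow> nat \<Rightarrow> nat \<Rightarrow> real" where
  "grid_weight \<mu> N i = measure \<mu> (grid_cell N i) + 1 / (real N + 1)^2"

lemma sets_grid_cell [measurable, simp]: "grid_cell N i \<in> sets borel"
proof -
  have "(\<lambda>t. nat \<lfloor>real N * t\<rfloor>) \<in> measurable borel (count_space UNIV)" by measurable
  then have "(\<lambda>t. nat \<lfloor>real N * t\<rfloor>) -` {i} \<inter> space borel \<in> sets borel"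
    by (rule measurable_sets) simp
  then show ?thesis by (simp add: grid_cell_def vimage_def)
qed

lemma grid_node_unit: "i \<le> N \<Longrightarrow> 0 < grid_node N i \<and> grid_node N i < 1"
  by (auto simp: grid_node_def)

lemma grid_node_floor_tendsto:
  assumes "0 \<le> t"
  shows "(\<lambda>N. grid_node N (nat \<lfloor>real N * t\<rfloor>)) \<longlonglongrightarrow> t"
proof (rule tendsto_sandwich)
  have eq: "real (nat \<lfloor>real N * t\<rfloor>) = of_int \<lfloor>real N * t\<rfloor>" for N
    using assms by simp
  show "\<forall>\<^sub>F N in sequentially. real N * t / (real N + 2) \<le> grid_node N (nat \<lfloor>real N * t\<rfloor>)"
    unfolding grid_node_def eq by (intro always_eventually allI divide_right_mono) linarith+
  show "\<forall>\<^sub>F N in sequentially. grid_node N (nat \<lfloor>real N * t\<rfloor>) \<le> (real N * t + 1) / (real N + 2)"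
    unfolding grid_node_def eq by (intro always_eventually allI divide_right_mono) linarith+
  show "(\<lambda>N. real N * t / (real N + 2)) \<longlonglongrightarrow> t" "(\<lambda>N. (real N * t + 1) / (real N + 2)) \<longlonglongrightarrow> t"
    by real_asymp+
qed

context unit_measure
begin

text \<open>
  Without the extra mass, the sum is the integral of the kernel composed with the step function that
  sends each cell to its node. These step functions converge to the identity, and dominated convergence
  applies because the kernel is bounded on \<open>[0,1]\<close>.
\<close>

lemma grid_sum_tendsto_transform:
  assumes z: "z \<in> slit_plane"
  shows "(\<lambda>N. \<Sum>i<N+1. grid_weight \<mu> N i * kernel z (grid_node N i)) \<longlonglongrightarrow> transform \<mu> z"
proof -
  obtain B where B: "\<And>t. 0 \<le> t \<Longrightarrow> t \<le> 1 \<Longrightarrow> norm (kernel z t) \<le> B"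
    by (rule kernel_bounded[OF z]) blast
  define g where "g N t = kernel z (grid_node N (nat \<lfloor>real N * t\<rfloor>))" for N t
  have idx: "nat \<lfloor>real N * t\<rfloor> \<le> N" if "0 \<le> t" "t \<le> 1" for N t
  proof -
    have "real N * t \<le> real N" using that by (simp add: mult_left_le)
    then show ?thesis by linarith
  qed
  have g_bound: "norm (g N t) \<le> B" if "0 \<le> t" "t \<le> 1" for N t
    unfolding g_def using grid_node_unit[OF idx[OF that, of N]] by (intro B) auto
  have [measurable]: "g N \<in> borel_measurable borel" for N
    unfolding g_def grid_node_def by measurable
  have sum_eq: "(\<Sum>i<N+1. measure \<mu> (grid_cell N i) * kernel z (grid_node N i)) = (LINT t|\<mu>. g N t)" for N
  proof -
    have "(LINT t|\<mu>. g N t) =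
        (LINT t|\<mu>. (\<Sum>i<N+1. indicator (grid_cell N i) t *\<^sub>R kernel z (grid_node N i)))"
    proof (rule integral_cong_AE)
      show "AE t in \<mu>. g N t = (\<Sum>i<N+1. indicator (grid_cell N i) t *\<^sub>R kernel z (grid_node N i))"
        using unit_supported
      proof eventually_elim
        case (elim t)
        let ?i = "nat \<lfloor>real N * t\<rfloor>"
        have "(\<Sum>i<N+1. indicator (grid_cell N i) t *\<^sub>R kernel z (grid_node N i)) =
            (\<Sum>i\<in>{?i}. indicator (grid_cell N i) t *\<^sub>R kernel z (grid_node N i))"
          using idx[of t N] elim
          by (intro sum.mono_neutral_right) (auto simp: grid_cell_def)
        then show ?case by (simp add: g_def grid_cell_def)
      qed
      show "(\<lambda>t. \<Sum>i<N+1. indicator (grid_cell N i) t *\<^sub>R kernel z (grid_node N i)) \<in> borel_measurable \<mu>"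
        by measurable
    qed simp
    also have "\<dots> = (\<Sum>i<N+1. measure \<mu> (grid_cell N i) *\<^sub>R kernel z (grid_node N i))"
      by (subst Bochner_Integration.integral_sum) (auto simp: emeasure_eq_measure)
    finally show ?thesis by (simp add: scaleR_conv_of_real)
  qed
  have "(\<lambda>N. LINT t|\<mu>. g N t) \<longlonglongrightarrow> transform \<mu> z"
    unfolding transform_def
  proof (rule integral_dominated_convergence[where w = "\<lambda>_. B"])
    show "AE t in \<mu>. (\<lambda>N. g N t) \<longlonglongrightarrow> kernel z t"
      using unit_supported
    proof eventually_elim
      case (elim t)
      show ?case unfolding g_def
        using elim grid_node_unit[OF idx[of t]]
        by (intro continuous_on_tendsto_compose[OF continuous_on_kernel[OF z] grid_node_floor_tendsto])
           (auto simp: less_imp_le intro!: always_eventually)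
    qed
    show "AE t in \<mu>. norm (g N t) \<le> B" for N
      using unit_supported by eventually_elim (rule g_bound, auto)
  qed simp_all
  moreover have "(\<lambda>N. \<Sum>i<N+1. of_real (1 / (real N + 1)^2) * kernel z (grid_node N i)) \<longlonglongrightarrow> 0"
  proof (rule Lim_null_comparison)
    show "\<forall>\<^sub>F N in sequentially. norm (\<Sum>i<N+1. of_real (1 / (real N + 1)^2) * kernel z (grid_node N i))
        \<le> B / (real N + 1)"
    proof (intro always_eventually allI)
      fix N
      have cancel: "x * (1 / x^2 * B) = B / x" if "x \<noteq> 0" for x :: real
        using that by (simp add: power2_eq_square)
      have "norm (\<Sum>i<N+1. of_real (1 / (real N + 1)^2) * kernel z (grid_node N i)) \<le>
          (\<Sum>i<N+1. 1 / (real N + 1)^2 * B)"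
      proof (rule sum_norm_le)
        fix i assume "i \<in> {..<N+1}"
        then have "norm (kernel z (grid_node N i)) \<le> B"
          using grid_node_unit[of i N] by (intro B) auto
        then show "norm (of_real (1 / (real N + 1)^2) * kernel z (grid_node N i)) \<le> 1 / (real N + 1)^2 * B"
          unfolding norm_mult norm_of_real by (simp add: divide_right_mono)
      qed
      also have "\<dots> = B / (real N + 1)"
        unfolding sum_constant card_lessThan of_nat_add of_nat_1 by (rule cancel) linarith
      finally show "norm (\<Sum>i<N+1. of_real (1 / (real N + 1)^2) * kernel z (grid_node N i)) \<le> B / (real N + 1)" .
    qed
    show "(\<lambda>N. B / (real N + 1)) \<longlonglongrightarrow> 0" by real_asymp
  qed
  ultimately have "(\<lambda>N. (LINT t|\<mu>. g N t) +
      (\<Sum>i<N+1. of_real (1 / (real N + 1)^2) * kernel z (grid_node N i))) \<longlonglongrightarrow> transform \<mu> z + 0"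
    by (rule tendsto_add)
  then show ?thesis
    unfolding sum_eq[symmetric] sum.distrib[symmetric] grid_weight_def by (simp add: algebra_simps)
qed

end

definition dual_pair :: "real measure \<Rightarrow> real measure \<Rightarrow> bool" where
  "dual_pair \<mu> \<nu> \<longleftrightarrow> unit_measure \<mu> \<and> unit_measure \<nu> \<and>
     (\<forall>z\<in>slit_plane. - z * transform \<mu> z * transform \<nu> z = 1)"

text \<open>
  The total mass of a measure is the value of its function at \<open>z = -1\<close>, so the masses of a discrete
  dual pair are reciprocal. Multiplied by the mass \<open>a N\<close> of the \<open>N\<close>-th approximation, its dual measure
  becomes a probability measure, to which the compactness lemma applies.
\<close>

lemma (in unit_measure) exists_dual_pair:
  assumes mass: "0 < measure \<mu> UNIV"
  shows "\<exists>\<nu>. dual_pair \<mu> \<nu>"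
proof -
  define A where "A N z = (\<Sum>i<N+1. grid_weight \<mu> N i * kernel z (grid_node N i))" for N z
  define dual_data where "dual_data N u q \<longleftrightarrow>
      (\<forall>j\<le>N+1. 0 \<le> u j \<and> u j \<le> 1) \<and> (\<forall>j\<le>N+1. 0 \<le> q j) \<and>
      (\<forall>z\<in>slit_plane. - z * A N z * (\<Sum>j\<le>N+1. complex_of_real (q j) * kernel z (u j)) = 1)"
    for N and u q :: "nat \<Rightarrow> real"
  have "\<exists>u q. dual_data N u q" for N
  proof -
    obtain u q :: "nat \<Rightarrow> real" where "\<And>j. j \<le> N+1 \<Longrightarrow> 0 \<le> u j \<and> u j \<le> 1" "\<And>j. j \<le> N+1 \<Longrightarrow> 0 \<le> q j"
      "\<And>z. z \<in> slit_plane \<Longrightarrow> - z * A N z * (\<Sum>j\<le>N+1. q j * kernel z (u j)) = 1"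
    proof (rule discrete_dual[of "N+1" "grid_node N" "grid_weight \<mu> N"])
      show "grid_node N i < grid_node N k" if "i < k" for i k
        using that by (simp add: grid_node_def divide_strict_right_mono)
      show "0 < grid_weight \<mu> N i" for i
        by (simp add: grid_weight_def add_nonneg_pos)
    qed (use grid_node_unit in \<open>auto simp: A_def\<close>)
    then show ?thesis unfolding dual_data_def by blast
  qed
  then obtain u q where "\<And>N. dual_data N (u N) (q N)" by metis
  then have u: "\<And>N j. j \<le> N+1 \<Longrightarrow> 0 \<le> u N j \<and> u N j \<le> 1"
    and q: "\<And>N j. j \<le> N+1 \<Longrightarrow> 0 \<le> q N j"
    and dual: "\<And>N z. z \<in> slit_plane \<Longrightarrow>
      - z * A N z * (\<Sum>j\<le>N+1. complex_of_real (q N j) * kernel z (u N j)) = 1"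
    unfolding dual_data_def by blast+
  define a where "a N = (\<Sum>i<N+1. grid_weight \<mu> N i)" for N
  have A_a: "A N (-1) = of_real (a N)" for N by (simp add: A_def a_def)
  have a_q: "a N * (\<Sum>j\<le>N+1. q N j) = 1" for N
  proof -
    have "complex_of_real (a N * (\<Sum>j\<le>N+1. q N j)) = 1"
      using dual[of "-1" N] by (simp add: A_a)
    then show ?thesis by (simp only: of_real_eq_1_iff)
  qed
  have a_pos: "0 < a N" for N
    unfolding a_def by (intro sum_pos) (auto simp: grid_weight_def add_nonneg_pos)
  define \<rho> where "\<rho> N = distr (point_measure {..N+1} (\<lambda>j. ennreal (a N * q N j))) borel (u N)" for N
  have aq: "0 \<le> a N * q N j" if "j \<le> N+1" for N j using a_pos[of N] q[OF that] by simp
  have \<rho>_unit: "unit_measure (\<rho> N)"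
    and \<rho>_transform: "transform (\<rho> N) z = (\<Sum>j\<le>N+1. of_real (a N * q N j) * kernel z (u N j))"
    and \<rho>_mass: "emeasure (\<rho> N) UNIV = ennreal (\<Sum>j\<le>N+1. a N * q N j)" for N z
    unfolding \<rho>_def by (rule finite_sum_as_unit_measure[OF u aq]; assumption)+
  have "prob_space (\<rho> N)" for N
    using \<rho>_mass[of N] a_q[of N] unit_measure.space_eq_UNIV[OF \<rho>_unit]
    by (intro prob_spaceI) (simp add: sum_distrib_left[symmetric])
  then obtain r \<nu> where r: "strict_mono r" and \<nu>: "unit_measure \<nu>"
    and lim: "\<And>z. z \<in> slit_plane \<Longrightarrow> (\<lambda>N. transform (\<rho> (r N)) z) \<longlonglongrightarrow> transform \<nu> z"
    using unit_measure_compactness[of \<rho>] \<rho>_unit by metis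
  have A_lim: "(\<lambda>N. A (r N) z) \<longlonglongrightarrow> transform \<mu> z" if "z \<in> slit_plane" for z
    using LIMSEQ_subseq_LIMSEQ[OF grid_sum_tendsto_transform[OF that] r] by (simp add: A_def o_def)
  have key: "- z * transform \<mu> z * transform \<nu> z = of_real (measure \<mu> UNIV)" if z: "z \<in> slit_plane" for z
  proof (rule LIMSEQ_unique)
    show "(\<lambda>N. - z * A (r N) z * transform (\<rho> (r N)) z) \<longlonglongrightarrow> - z * transform \<mu> z * transform \<nu> z"
      by (intro tendsto_intros A_lim lim z)
    have "- z * A N z * transform (\<rho> N) z = A N (-1)" for N
    proof -
      have "transform (\<rho> N) z = of_real (a N) * (\<Sum>j\<le>N+1. complex_of_real (q N j) * kernel z (u N j))"
        unfolding \<rho>_transform sum_distrib_left by (simp add: mult_ac)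
      then have "- z * A N z * transform (\<rho> N) z =
          of_real (a N) * (- z * A N z * (\<Sum>j\<le>N+1. complex_of_real (q N j) * kernel z (u N j)))"
        by (simp only: mult_ac)
      then show ?thesis by (simp only: dual[OF z] A_a mult_1_right)
    qed
    then show "(\<lambda>N. - z * A (r N) z * transform (\<rho> (r N)) z) \<longlonglongrightarrow> of_real (measure \<mu> UNIV)"
      using A_lim[of "-1"] by (simp add: transform_minus_one)
  qed
  let ?\<nu> = "density \<nu> (\<lambda>_. ennreal (1 / measure \<mu> UNIV))"
  have unit: "unit_measure ?\<nu>"
    and scaled: "transform ?\<nu> z = of_real (1 / measure \<mu> UNIV) * transform \<nu> z" for z
    using unit_measure.density_const_unit[OF \<nu>, of "1 / measure \<mu> UNIV"] by auto
  have "- z * transform \<mu> z * transform ?\<nu> z = 1" if "z \<in> slit_plane" for z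
  proof -
    have "- z * transform \<mu> z * transform ?\<nu> z =
        of_real (1 / measure \<mu> UNIV) * (- z * transform \<mu> z * transform \<nu> z)"
      unfolding scaled by (simp only: mult_ac)
    also have "\<dots> = 1"
      unfolding key[OF that] using mass by (simp flip: of_real_mult)
    finally show ?thesis .
  qed
  then have "dual_pair \<mu> ?\<nu>"
    unfolding dual_pair_def using unit unit_measure_axioms by blast
  then show ?thesis by blast
qed

section \<open>A measure on the unit interval is determined by its function\<close>

context unit_measure
begin

text \<open>
  The integral of any absolutely summable power series depends on the moments only. It is used for the
  geometric series, to read the moments off from the function near \<open>z = -1\<close>, and for the exponential
  series, to recover the characteristic function from the moments.
\<close>

lemma integral_power_series:
  fixes c :: "nat \<Rightarrow> complex"
  assumes c: "summable (\<lambda>n. norm (c n))"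
  shows "(\<lambda>n. c n * of_real (LINT t|\<mu>. t ^ n)) sums (LINT t|\<mu>. (\<Sum>n. c n * of_real (t ^ n)))"
proof -
  have bound: "norm (c n * of_real (t ^ n)) \<le> norm (c n)" if "0 \<le> t" "t \<le> 1" for n t
    using that by (simp add: norm_mult norm_power mult_left_le power_le_one)
  have int: "integrable \<mu> (\<lambda>t. c n * of_real (t ^ n))" for n
    by (rule integrable_bounded_on_unit[OF _ bound]) auto
  have "(\<lambda>n. LINT t|\<mu>. c n * of_real (t ^ n)) sums (LINT t|\<mu>. (\<Sum>n. c n * of_real (t ^ n)))"
  proof (rule sums_integral[OF int])
    show "AE t in \<mu>. summable (\<lambda>n. norm (c n * of_real (t ^ n)))"
      using unit_supported
    proof eventually_elim
      case (elim t)
      then show ?case by (intro summable_comparison_test[OF _ c]) (use bound in auto)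
    qed
    have "(LINT t|\<mu>. norm (c n * of_real (t ^ n))) \<le> (LINT t|\<mu>. norm (c n))" for n
    proof (rule integral_mono_AE)
      show "AE t in \<mu>. norm (c n * of_real (t ^ n)) \<le> norm (c n)"
        using unit_supported by eventually_elim (use bound in auto)
    qed (use int in auto)
    then show "summable (\<lambda>n. LINT t|\<mu>. norm (c n * of_real (t ^ n)))"
      by (intro summable_comparison_test[OF _ summable_mult2[OF c, of "measure \<mu> UNIV"]])
         (auto intro!: exI[of _ 0] simp: mult.commute)
  qed
  moreover have "(LINT t|\<mu>. c n * of_real (t ^ n)) = c n * of_real (LINT t|\<mu>. t ^ n)" for n
  proof -
    have "(LINT t|\<mu>. c n * of_real (t ^ n)) = c n * (LINT t|\<mu>. of_real (t ^ n))"
      by (rule integral_mult_right_zero)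
    then show ?thesis by (simp only: integral_complex_of_real)
  qed
  ultimately show ?thesis by (simp only:)
qed

lemma transform_power_series:
  assumes q: "norm q < 1"
  shows "(\<lambda>n. of_real (LINT t|\<mu>. t ^ n) * q ^ n) sums transform \<mu> (q - 1)"
proof -
  have "(LINT t|\<mu>. (\<Sum>n. q ^ n * of_real (t ^ n))) = transform \<mu> (q - 1)"
    unfolding transform_def
  proof (rule integral_cong_AE)
    show "AE t in \<mu>. (\<Sum>n. q ^ n * of_real (t ^ n)) = kernel (q - 1) t"
      using unit_supported
    proof eventually_elim
      case (elim t)
      have "norm (q * of_real t) < 1"
        using q elim mult_left_le[of t "norm q"] by (simp add: norm_mult)
      then have "(\<lambda>n. (q * of_real t) ^ n) sums (1 / (1 - q * of_real t))"
        by (rule geometric_sums)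
      then show ?case
        by (simp add: kernel_def power_mult_distrib algebra_simps sums_iff)
    qed
  qed measurable
  then show ?thesis
    using integral_power_series[of "\<lambda>n. q ^ n"] q
    by (simp add: norm_power summable_geometric mult.commute)
qed

lemma char_power_series:
  "(\<lambda>n. (\<i> * of_real s) ^ n / fact n * of_real (LINT t|\<mu>. t ^ n)) sums char \<mu> s"
proof -
  let ?c = "\<lambda>n. (\<i> * of_real s) ^ n / (fact n :: complex)"
  have "summable (\<lambda>n. norm (?c n))"
    using summable_norm_exp[of "\<i> * of_real s"] by (simp add: norm_divide norm_mult norm_power field_simps)
  moreover have "(\<Sum>n. ?c n * of_real (t ^ n)) = iexp (s * t)" for t
    by (simp add: exp_def scaleR_conv_of_real power_mult_distrib field_simps)
  ultimately show ?thesis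
    using integral_power_series[of ?c] unfolding char_def by simp
qed

end

lemma slit_plane_near_minus_one:
  fixes q :: complex
  assumes "norm q < 1" shows "q - 1 \<in> slit_plane"
proof
  assume "q - 1 \<in> \<real>\<^sub>\<ge>\<^sub>0"
  then have "1 \<le> Re q" by (simp add: complex_nonneg_Reals_iff)
  then show False using assms complex_Re_le_cmod[of q] by linarith
qed

text \<open>
  The function determines the moments as its Taylor coefficients at \<open>z = -1\<close>. The moments determine the
  characteristic function, and then Levy's uniqueness theorem applies after both measures have been
  scaled to total mass \<open>1\<close>.
\<close>

lemma transform_inj:
  assumes \<mu>: "unit_measure \<mu>" and \<nu>: "unit_measure \<nu>"
    and eq: "\<And>z. z \<in> slit_plane \<Longrightarrow> transform \<mu> z = transform \<nu> z"
  shows "\<mu> = \<nu>"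
proof -
  interpret \<mu>: unit_measure \<mu> by fact
  interpret \<nu>: unit_measure \<nu> by fact
  define f where "f M = Abs_fps (\<lambda>n. complex_of_real (LINT t|M. t ^ n))" for M :: "real measure"
  have f_sums: "(\<lambda>n. fps_nth (f M) n * q ^ n) sums transform M (q - 1)"
    if "unit_measure M" "norm q < 1" for M q
    using unit_measure.transform_power_series[OF that] by (simp add: f_def)
  have f_radius: "fps_conv_radius (f M) > 0" if "unit_measure M" for M
  proof -
    have "summable (\<lambda>n. fps_nth (f M) n * (1/2) ^ n)"
      using f_sums[OF that, of "1/2"] by (auto simp: sums_iff)
    then have "conv_radius (fps_nth (f M)) \<ge> norm (1/2 :: complex)"
      by (rule conv_radius_geI)
    then show ?thesis
      unfolding fps_conv_radius_def by (rule less_le_trans[rotated]) simp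
  qed
  have "f \<mu> = f \<nu>"
  proof (rule eval_fps_eqD[OF f_radius[OF \<mu>] f_radius[OF \<nu>]])
    have "eval_fps (f \<mu>) q = eval_fps (f \<nu>) q" if "norm q < 1" for q
      using f_sums[OF \<mu> that] f_sums[OF \<nu> that] eq[OF slit_plane_near_minus_one[OF that]]
      by (simp add: eval_fps_def sums_iff)
    moreover have "\<forall>\<^sub>F q in nhds 0. norm (q :: complex) < 1"
      using eventually_nhds_ball[of 1 "0 :: complex"] by (simp add: dist_norm)
    ultimately show "\<forall>\<^sub>F q in nhds 0. eval_fps (f \<mu>) q = eval_fps (f \<nu>) q"
      by (auto elim: eventually_mono)
  qed
  then have moments: "complex_of_real (LINT t|\<mu>. t ^ n) = of_real (LINT t|\<nu>. t ^ n)" for n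
    unfolding f_def fps_eq_iff by simp
  have char: "char \<mu> = char \<nu>"
    using sums_unique2[OF \<mu>.char_power_series] \<nu>.char_power_series by (auto simp: moments fun_eq_iff)
  define m where "m = measure \<mu> UNIV"
  have mass: "measure \<mu> UNIV = m" "measure \<nu> UNIV = m"
    using moments[of 0] by (auto simp: m_def)
  show ?thesis
  proof (cases "m = 0")
    case True
    have "emeasure M A = 0" if "unit_measure M" "measure M UNIV = 0" for M A
    proof -
      interpret unit_measure M by fact
      have "emeasure M A \<le> emeasure M UNIV" by (rule emeasure_mono) auto
      then show ?thesis using that(2) by (simp add: emeasure_eq_measure)
    qed
    then show ?thesis
      using True mass \<mu> \<nu> by (intro measure_eqI) auto
  next
    case False
    then have m: "m > 0" by (simp add: m_def zero_less_measure_iff)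
    let ?n = "\<lambda>M. density M (\<lambda>_. ennreal (1 / m))"
    have distr: "real_distribution (?n M)" if "unit_measure M" "measure M UNIV = m" for M
    proof -
      interpret unit_measure M by fact
      have "emeasure (?n M) UNIV = ennreal (1 / m) * ennreal m"
        using that(2) by (simp add: emeasure_density emeasure_eq_measure)
      then have "emeasure (?n M) UNIV = 1" using m by (simp flip: ennreal_mult)
      then show ?thesis
        by (intro real_distribution.intro prob_spaceI real_distribution_axioms.intro) auto
    qed
    have "char (?n M) s = of_real (1 / m) * char M s" if "unit_measure M" for M s
    proof -
      interpret unit_measure M by fact
      show ?thesis unfolding char_def using m
        by (subst integral_density) (auto simp: scaleR_conv_of_real)
    qed
    then have "char (?n \<mu>) = char (?n \<nu>)" using \<mu> \<nu> char by (auto simp: fun_eq_iff)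
    then have n_eq: "?n \<mu> = ?n \<nu>"
      using distr \<mu> \<nu> mass by (intro Levy_uniqueness) auto
    have undo: "emeasure M A = ennreal m * emeasure (?n M) A" if "unit_measure M" "A \<in> sets borel" for M A
    proof -
      interpret unit_measure M by fact
      have "emeasure (?n M) A = ennreal (1 / m) * emeasure M A"
        using that(2) by (simp add: emeasure_density nn_integral_cmult_indicator)
      then have "ennreal m * emeasure (?n M) A = (ennreal m * ennreal (1 / m)) * emeasure M A"
        by (simp add: mult.assoc)
      also have "ennreal m * ennreal (1 / m) = 1" using m by (simp flip: ennreal_mult)
      finally show ?thesis by simp
    qed
    show ?thesis
      by (rule measure_eqI) (use undo[OF \<mu>] undo[OF \<nu>] n_eq in auto)
  qed
qed

section \<open>Reflection of the unit interval\<close>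

definition reflect :: "real measure \<Rightarrow> real measure" where
  "reflect \<mu> = distr \<mu> borel (\<lambda>t. 1 - t)"

lemma kernel_reflect: "z \<noteq> 0 \<Longrightarrow> kernel z (1 - t) = 1 / (- z) * kernel (1 / z) t"
proof -
  assume "z \<noteq> 0"
  then have "of_real (1 - (1 - t)) - of_real (1 - t) * z = - z * (of_real (1 - t) - of_real t * (1 / z))"
    by (simp add: algebra_simps)
  then show ?thesis by (simp only: kernel_def) simp
qed

lemma slit_plane_nonzero: "z \<in> slit_plane \<Longrightarrow> z \<noteq> (0 :: complex)"
  by auto

lemma inverse_slit_plane: "z \<in> slit_plane \<Longrightarrow> 1 / z \<in> (slit_plane :: complex set)"
proof (rule ccontr)
  assume z: "z \<in> slit_plane" and "1 / z \<notin> slit_plane"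
  then have "inverse (1 / z) \<in> \<real>\<^sub>\<ge>\<^sub>0" by (intro nonneg_Reals_inverse_I) auto
  then show False using z by (simp add: slit_plane_nonzero)
qed

context unit_measure
begin

lemma unit_measure_reflect: "unit_measure (reflect \<mu>)"
proof (intro unit_measure.intro unit_measure_axioms.intro)
  show "finite_measure (reflect \<mu>)" unfolding reflect_def by (rule finite_measure_distr) simp
  show "AE t in reflect \<mu>. 0 \<le> t \<and> t \<le> 1"
    unfolding reflect_def using unit_supported by (subst AE_distr_iff) (auto elim: eventually_mono)
qed (simp add: reflect_def)

lemma transform_reflect:
  "z \<in> slit_plane \<Longrightarrow> transform (reflect \<mu>) z = 1 / (- z) * transform \<mu> (1 / z)"
  unfolding transform_def reflect_def
  by (subst integral_distr) (simp_all add: kernel_reflect slit_plane_nonzero)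

lemma reflect_reflect: "reflect (reflect \<mu>) = \<mu>"
  unfolding reflect_def by (simp add: distr_distr o_def distr_id2)

end

lemma dual_pair_commute: "dual_pair \<mu> \<nu> \<Longrightarrow> dual_pair \<nu> \<mu>"
  unfolding dual_pair_def by (simp add: mult_ac)

lemma dual_pair_reflect:
  assumes "dual_pair \<mu> \<nu>" shows "dual_pair (reflect \<mu>) (reflect \<nu>)"
  unfolding dual_pair_def
proof (intro conjI ballI)
  have \<mu>: "unit_measure \<mu>" and \<nu>: "unit_measure \<nu>"
    and eq: "\<And>z. z \<in> slit_plane \<Longrightarrow> - z * transform \<mu> z * transform \<nu> z = 1"
    using assms by (auto simp: dual_pair_def)
  show "unit_measure (reflect \<mu>)" "unit_measure (reflect \<nu>)"
    using \<mu> \<nu> by (auto intro: unit_measure.unit_measure_reflect)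
  fix z :: complex assume z: "z \<in> slit_plane"
  have "- z * transform (reflect \<mu>) z * transform (reflect \<nu>) z =
      - (1 / z) * transform \<mu> (1 / z) * transform \<nu> (1 / z)"
    using slit_plane_nonzero[OF z]
    by (simp add: unit_measure.transform_reflect[OF \<mu> z] unit_measure.transform_reflect[OF \<nu> z])
  then show "- z * transform (reflect \<mu>) z * transform (reflect \<nu>) z = 1"
    using eq[OF inverse_slit_plane[OF z]] by simp
qed

section \<open>Passage between measures on the unit interval and spectral functions\<close>

text \<open>
  The measure \<open>d\<sigma>\<close> that belongs to \<open>\<mu>\<close> under \<open>\<lambda> = 1/t - 1\<close>. Since \<open>1 / 0 = 0\<close>, the density removes
  the atom of \<open>\<mu>\<close> at \<open>0\<close>, whose mass is the separate constant \<open>c\<close>.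
\<close>

definition spectral_measure :: "real measure \<Rightarrow> real measure" where
  "spectral_measure \<mu> = distr (density \<mu> (\<lambda>t. ennreal (1 / t))) borel (\<lambda>t. 1 / t - 1)"

lemma sets_spectral_measure [simp, measurable_cong]: "sets (spectral_measure \<mu>) = sets borel"
  by (simp add: spectral_measure_def)

lemma space_spectral_measure [simp]: "space (spectral_measure \<mu>) = UNIV"
  by (simp add: spectral_measure_def)

lemma nn_integral_spectral_measure:
  assumes "sets \<mu> = sets borel" and [measurable]: "f \<in> borel_measurable borel"
  shows "(\<integral>\<^sup>+x. f x \<partial>spectral_measure \<mu>) = (\<integral>\<^sup>+t. ennreal (1 / t) * f (1 / t - 1) \<partial>\<mu>)"
proof -
  note assms(1)[measurable_cong]
  show ?thesis
    unfolding spectral_measure_def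
    by (subst nn_integral_distr, measurable, subst nn_integral_density) auto
qed

context unit_measure
begin

lemma finite_spectral_measure_atMost: "emeasure (spectral_measure \<mu>) {..b} < \<infinity>"
proof -
  have "emeasure (spectral_measure \<mu>) {..b} = (\<integral>\<^sup>+x. indicator {..b} x \<partial>spectral_measure \<mu>)"
    by simp
  also have "\<dots> = (\<integral>\<^sup>+t. ennreal (1 / t) * indicator {..b} (1 / t - 1) \<partial>\<mu>)"
    by (rule nn_integral_spectral_measure) auto
  also have "\<dots> \<le> (\<integral>\<^sup>+t. ennreal (b + 1) \<partial>\<mu>)"
    by (intro nn_integral_mono) (auto simp: indicator_def intro!: ennreal_leI)
  also have "\<dots> = ennreal (b + 1) * emeasure \<mu> UNIV" by simp
  also have "\<dots> < \<infinity>" by (simp add: emeasure_eq_measure ennreal_mult_less_top)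
  finally show ?thesis .
qed

lemma spectral_measure_negative: "emeasure (spectral_measure \<mu>) {..<0} = 0"
proof -
  have "emeasure (spectral_measure \<mu>) {..<0} = (\<integral>\<^sup>+x. indicator {..<0} x \<partial>spectral_measure \<mu>)"
    by simp
  also have "\<dots> = (\<integral>\<^sup>+t. ennreal (1 / t) * indicator {..<0} (1 / t - 1) \<partial>\<mu>)"
    by (rule nn_integral_spectral_measure) auto
  also have "\<dots> = 0"
  proof (rule nn_integral_0_iff_AE[THEN iffD2])
    show "AE t in \<mu>. ennreal (1 / t) * indicator {..<0} (1 / t - 1) = 0"
      using unit_supported
    proof eventually_elim
      case (elim t)
      then show ?case by (cases "t = 0") (auto simp: indicator_def field_simps)
    qed
  qed measurable
  finally show ?thesis .
qed

text \<open>
  The spectral measure may be infinite, but it is finite on half-lines \<open>(-\<infinity>, b]\<close>, so its distribution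
  function is a spectral function. The integrability condition holds because
  \<open>1 / (1 + \<lambda>) = t\<close> cancels the density \<open>1 / t\<close>.
\<close>

lemma exists_spectral_function:
  "\<exists>\<sigma>. spectral_function \<sigma> \<and> interval_measure \<sigma> = spectral_measure \<mu>"
proof (intro exI conjI)
  let ?\<rho> = "spectral_measure \<mu>"
  define \<sigma> where "\<sigma> x = measure ?\<rho> {..x}" for x
  have fin: "emeasure ?\<rho> {..b} \<noteq> \<infinity>" for b using finite_spectral_measure_atMost[of b] by simp
  have fmeas: "{..b} \<in> fmeasurable ?\<rho>" for b
    using finite_spectral_measure_atMost[of b] by (intro fmeasurableI) auto
  have mono: "mono \<sigma>"
    unfolding \<sigma>_def by (intro monoI measure_mono_fmeasurable fmeas) auto
  have rcont: "continuous (at_right a) \<sigma>" for a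
    unfolding continuous_within
  proof (rule tendsto_at_right_sequentially[where b="a + 1"])
    fix f :: "nat \<Rightarrow> real" assume f: "decseq f" "f \<longlonglongrightarrow> a"
    then have "(\<lambda>n. \<sigma> (f n)) \<longlonglongrightarrow> measure ?\<rho> (\<Inter>i. {..f i})"
      unfolding \<sigma>_def using fin by (intro Lim_measure_decseq) (auto simp: decseq_def)
    also have "(\<Inter>i. {..f i}) = {..a}"
      using decseq_ge[OF f] by (auto intro: order_trans LIMSEQ_le_const[OF f(2)])
    finally show "(\<lambda>n. \<sigma> (f n)) \<longlonglongrightarrow> \<sigma> a" by (simp add: \<sigma>_def)
  qed simp
  have Ioc: "emeasure ?\<rho> {a<..b} = ennreal (\<sigma> b - \<sigma> a)" if "a \<le> b" for a b
  proof -
    have "{a<..b} = {..b} - {..a}" using that by auto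
    then have "emeasure ?\<rho> {a<..b} = emeasure ?\<rho> {..b} - emeasure ?\<rho> {..a}"
      using that fin by (simp only:) (rule emeasure_Diff, auto)
    also have "\<dots> = ennreal (\<sigma> b - \<sigma> a)"
      unfolding \<sigma>_def using fin by (simp add: emeasure_eq_ennreal_measure ennreal_minus)
    finally show ?thesis .
  qed
  show meas: "interval_measure \<sigma> = ?\<rho>"
  proof (rule measure_eqI_generator_eq)
    let ?E = "range (\<lambda>(a, b). {a<..b::real})"
    show "Int_stable ?E" by (auto simp: Int_stable_def)
    show "?E \<subseteq> Pow UNIV" by simp
    show "sets (interval_measure \<sigma>) = sigma_sets UNIV ?E" "sets ?\<rho> = sigma_sets UNIV ?E"
      by (simp_all add: borel_sigma_sets_Ioc)
    show "emeasure (interval_measure \<sigma>) X = emeasure ?\<rho> X" if "X \<in> ?E" for X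
    proof -
      from that obtain a b where X: "X = {a<..b}" by auto
      show ?thesis
      proof (cases "a \<le> b")
        case True
        then show ?thesis unfolding X Ioc[OF True]
          by (intro emeasure_interval_measure_Ioc monoD[OF mono] rcont)
      qed (simp add: X)
    qed
    show "range (\<lambda>n. {- real n<..real n}) \<subseteq> ?E" by auto
    show "(\<Union>n. {- real n<..real n}) = UNIV"
    proof (intro set_eqI iffI UNIV_I)
      fix x :: real
      obtain n where "\<bar>x\<bar> < real n" using reals_Archimedean2 by blast
      then show "x \<in> (\<Union>n. {- real n<..real n})" by (intro UN_I[of n]) auto
    qed
    show "emeasure (interval_measure \<sigma>) {- real n<..real n} \<noteq> \<infinity>" for n
      by (subst emeasure_interval_measure_Ioc) (auto intro: monoD[OF mono] rcont)
  qed
  have "\<sigma> x = 0" if "x < 0" for x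
  proof -
    have "emeasure ?\<rho> {..x} \<le> emeasure ?\<rho> {..<0}" using that by (intro emeasure_mono) auto
    then show ?thesis by (simp add: \<sigma>_def measure_def spectral_measure_negative)
  qed
  moreover have "(\<integral>\<^sup>+x\<in>{0..}. ennreal (1 / (1 + x)) \<partial>?\<rho>) < \<infinity>"
  proof -
    have "(\<integral>\<^sup>+x\<in>{0..}. ennreal (1 / (1 + x)) \<partial>?\<rho>) =
        (\<integral>\<^sup>+t. ennreal (1 / t) * (ennreal (1 / (1 + (1 / t - 1))) * indicator {0..} (1 / t - 1)) \<partial>\<mu>)"
      by (rule nn_integral_spectral_measure) auto
    also have "\<dots> \<le> (\<integral>\<^sup>+t. 1 \<partial>\<mu>)"
    proof (rule nn_integral_mono)
      fix t :: real
      show "ennreal (1 / t) * (ennreal (1 / (1 + (1 / t - 1))) * indicator {0..} (1 / t - 1)) \<le> 1"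
      proof (cases "0 < t")
        case True
        then have "ennreal (1 / t) * ennreal t = 1" by (simp flip: ennreal_mult)
        then show ?thesis using True by (simp add: indicator_def)
      next
        case False
        then have "ennreal (1 / t) = 0" by (intro ennreal_neg) (simp add: divide_nonneg_neg field_simps)
        then show ?thesis by simp
      qed
    qed
    also have "\<dots> < \<infinity>" by (simp add: emeasure_eq_measure)
    finally show ?thesis .
  qed
  ultimately show "spectral_function \<sigma>"
    unfolding spectral_function_def meas using mono rcont by blast
qed

text \<open>
  Splitting off the atom at \<open>t = 0\<close>, where the kernel is \<open>1\<close>, leaves the integral over \<open>(0,1]\<close>,
  which the substitution \<open>\<lambda> = 1/t - 1\<close> turns into the Cauchy integral of the spectral measure.
\<close>

lemma transform_eq_spectral_integral:
  assumes z: "z \<in> slit_plane"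
  shows "transform \<mu> z = of_real (measure \<mu> {0}) +
    (LINT x:{0..}|spectral_measure \<mu>. 1 / (complex_of_real x - z))"
proof -
  have "(LINT x:{0..}|spectral_measure \<mu>. 1 / (complex_of_real x - z)) =
      (LINT t|density \<mu> (\<lambda>t. ennreal (1 / t)). indicator {0..} (1 / t - 1) *\<^sub>R (1 / (complex_of_real (1 / t - 1) - z)))"
    unfolding set_lebesgue_integral_def spectral_measure_def by (subst integral_distr) auto
  also have "\<dots> = (LINT t|\<mu>. (1 / t) *\<^sub>R (indicator {0..} (1 / t - 1) *\<^sub>R (1 / (complex_of_real (1 / t - 1) - z))))"
    using unit_supported by (subst integral_density) (auto elim: eventually_mono)
  also have "\<dots> = (LINT t|\<mu>. kernel z t - indicator {0} t *\<^sub>R 1)"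
  proof (rule integral_cong_AE)
    show "AE t in \<mu>. (1 / t) *\<^sub>R (indicator {0..} (1 / t - 1) *\<^sub>R (1 / (complex_of_real (1 / t - 1) - z))) =
        kernel z t - indicator {0} t *\<^sub>R 1"
      using unit_supported
    proof eventually_elim
      case (elim t)
      show ?case
      proof (cases "t = 0")
        case True
        then show ?thesis by (simp add: kernel_def)
      next
        case False
        then have "0 \<le> 1 / t - 1" using elim by (simp add: field_simps)
        moreover have "of_real (1 - t) - of_real t * z = complex_of_real t * (complex_of_real (1 / t - 1) - z)"
          using False by (simp add: algebra_simps)
        ultimately show ?thesis unfolding kernel_def using False
          by (simp add: scaleR_conv_of_real)
      qed
    qed
  qed simp_all
  also have "\<dots> = transform \<mu> z - (LINT t|\<mu>. indicator {0} t *\<^sub>R 1)"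
    unfolding transform_def
    by (rule Bochner_Integration.integral_diff[OF integrable_kernel[OF z]]) (auto simp: emeasure_eq_measure)
  also have "(LINT t|\<mu>. indicator {0} t *\<^sub>R (1 :: complex)) = of_real (measure \<mu> {0})"
    by (simp add: scaleR_conv_of_real)
  finally show ?thesis by simp
qed

end

lemma spectral_function_AE_nonneg:
  assumes "spectral_function \<sigma>"
  shows "AE x in interval_measure \<sigma>. 0 \<le> x"
proof (rule AE_I')
  \<comment> \<open>Bounded half-open intervals that exhaust the negative half-line.\<close>
  show "(\<Union>n. {- real n<..- 1 / (real n + 1)}) \<in> null_sets (interval_measure \<sigma>)"
  proof (intro null_sets_UN null_setsI)
    fix n :: nat
    show "emeasure (interval_measure \<sigma>) {- real n<..- 1 / (real n + 1)} = 0"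
    proof (cases "n = 0")
      case False
      then show ?thesis using assms
        by (subst emeasure_interval_measure_Ioc_eq)
           (auto simp: spectral_function_def mono_def divide_neg_pos)
    qed simp
  qed simp
  show "{x \<in> space (interval_measure \<sigma>). \<not> 0 \<le> x} \<subseteq> (\<Union>n. {- real n<..- 1 / (real n + 1)})"
  proof safe
    fix x :: real assume "\<not> 0 \<le> x"
    then have "0 < - x" by simp
    obtain n where "max (- x) (1 / (- x)) < real n" using reals_Archimedean2 by blast
    then have "- x < real n" "1 / (- x) \<le> real n + 1" by auto
    moreover from this have "1 / (real n + 1) \<le> - x"
      using \<open>0 < - x\<close> by (simp add: field_simps)
    ultimately show "x \<in> (\<Union>n. {- real n<..- 1 / (real n + 1)})" by (intro UN_I[of n]) auto
  qed
qed

definition add_atom :: "ennreal \<Rightarrow> real measure \<Rightarrow> real measure" where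
  "add_atom c \<kappa> = measure_of UNIV (sets borel) (\<lambda>A. c * indicator A 0 + emeasure \<kappa> A)"

lemma sets_add_atom [simp, measurable_cong]: "sets (add_atom c \<kappa>) = sets borel"
  unfolding add_atom_def by (simp add: sets.sigma_sets_eq[of borel, simplified])

lemma emeasure_add_atom:
  assumes "sets \<kappa> = sets borel" "A \<in> sets borel"
  shows "emeasure (add_atom c \<kappa>) A = c * indicator A 0 + emeasure \<kappa> A"
  unfolding add_atom_def
proof (rule emeasure_measure_of_sigma)
  show "sigma_algebra UNIV (sets (borel :: real measure))"
    using sets.sigma_algebra_axioms[of "borel :: real measure"] by simp
  show "positive (sets borel) (\<lambda>A. c * indicator A 0 + emeasure \<kappa> A)"
    by (simp add: positive_def)
  show "countably_additive (sets borel) (\<lambda>A. c * indicator A 0 + emeasure \<kappa> A)"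
  proof (rule countably_additiveI)
    fix F :: "nat \<Rightarrow> real set"
    assume F: "range F \<subseteq> sets borel" "disjoint_family F" "(\<Union>i. F i) \<in> sets borel"
    have "(\<Sum>i. c * indicator (F i) 0 + emeasure \<kappa> (F i)) =
        c * (\<Sum>i. indicator (F i) 0) + (\<Sum>i. emeasure \<kappa> (F i))"
      by (simp flip: suminf_add)
    also have "(\<Sum>i. indicator (F i) (0 :: real)) = (indicator (\<Union>i. F i) 0 :: ennreal)"
      using F(2) by (rule suminf_indicator)
    also have "(\<Sum>i. emeasure \<kappa> (F i)) = emeasure \<kappa> (\<Union>i. F i)"
      using F assms(1) by (intro suminf_emeasure) auto
    finally show "(\<Sum>i. c * indicator (F i) 0 + emeasure \<kappa> (F i)) =
        c * indicator (\<Union>i. F i) 0 + emeasure \<kappa> (\<Union>i. F i)" .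
  qed
qed fact

text \<open>
  Here \<open>\<kappa>\<close> is the image of \<open>d\<sigma>(\<lambda>) / (1 + \<lambda>)\<close> under \<open>\<lambda> \<mapsto> 1 / (1 + \<lambda>)\<close>. It has no atom at \<open>0\<close>, so an
  atom of mass \<open>c\<close> can be added there without changing the spectral measure.
\<close>

lemma exists_unit_measure:
  assumes \<sigma>: "spectral_function \<sigma>" and c: "c < \<infinity>"
  shows "\<exists>\<mu>. unit_measure \<mu> \<and> emeasure \<mu> {0} = c \<and> spectral_measure \<mu> = interval_measure \<sigma>"
proof -
  let ?\<rho> = "interval_measure \<sigma>"
  define \<kappa> where "\<kappa> = distr (density ?\<rho> (\<lambda>x. ennreal (1 / (1 + x)))) borel (\<lambda>x. 1 / (1 + x))"
  note nonneg = spectral_function_AE_nonneg[OF \<sigma>]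
  have sets_\<kappa> [simp, measurable_cong]: "sets \<kappa> = sets borel" by (simp add: \<kappa>_def)
  have nn_\<kappa>: "(\<integral>\<^sup>+t. f t \<partial>\<kappa>) = (\<integral>\<^sup>+x. ennreal (1 / (1 + x)) * f (1 / (1 + x)) \<partial>?\<rho>)"
    if [measurable]: "f \<in> borel_measurable borel" for f
    unfolding \<kappa>_def by (subst nn_integral_distr, measurable, subst nn_integral_density) auto
  have AE_\<kappa>: "AE t in \<kappa>. 0 < t \<and> t \<le> 1"
    unfolding \<kappa>_def using nonneg
    by (subst AE_distr_iff, measurable, subst AE_density) (auto elim!: eventually_mono)
  have "emeasure \<kappa> UNIV = (\<integral>\<^sup>+t. 1 \<partial>\<kappa>)" using sets_eq_imp_space_eq[OF sets_\<kappa>] by simp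
  also have "\<dots> = (\<integral>\<^sup>+x. ennreal (1 / (1 + x)) \<partial>?\<rho>)" by (subst nn_\<kappa>) auto
  also have "\<dots> = (\<integral>\<^sup>+x\<in>{0..}. ennreal (1 / (1 + x)) \<partial>?\<rho>)"
    using nonneg by (intro nn_integral_cong_AE) (auto elim!: eventually_mono)
  also have "\<dots> < \<infinity>" using \<sigma> by (simp add: spectral_function_def)
  finally have fin_\<kappa>: "emeasure \<kappa> UNIV < \<infinity>" .
  have null: "emeasure \<kappa> N = 0" if "N \<in> sets borel" "N \<inter> {0<..1} = {}" for N
  proof -
    have "AE t in \<kappa>. t \<notin> N" using AE_\<kappa> by eventually_elim (use that(2) in auto)
    then have "N \<in> null_sets \<kappa>" using that(1) by (subst AE_iff_null_sets) auto
    then show ?thesis by auto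
  qed
  have \<kappa>_0: "emeasure \<kappa> {0} = 0" by (rule null) auto
  define \<mu> where "\<mu> = add_atom c \<kappa>"
  have sets_\<mu> [simp, measurable_cong]: "sets \<mu> = sets borel" by (simp add: \<mu>_def)
  have space_\<mu> [simp]: "space \<mu> = UNIV" using sets_eq_imp_space_eq[OF sets_\<mu>] by simp
  have em: "emeasure \<mu> A = c * indicator A 0 + emeasure \<kappa> A" if "A \<in> sets borel" for A
    unfolding \<mu>_def by (rule emeasure_add_atom[OF sets_\<kappa> that])
  have "unit_measure \<mu>"
  proof (intro unit_measure.intro unit_measure_axioms.intro finite_measureI)
    show "emeasure \<mu> (space \<mu>) \<noteq> \<infinity>" using c fin_\<kappa> by (auto simp: em)
    have "emeasure \<kappa> (- {0..1}) = 0" by (rule null) auto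
    then have "- {0..1} \<in> null_sets \<mu>" by (simp add: null_sets_def em)
    then show "AE t in \<mu>. 0 \<le> t \<and> t \<le> 1" by (rule AE_I') auto
  qed simp
  moreover have "emeasure \<mu> {0} = c" by (simp add: em \<kappa>_0)
  moreover have "spectral_measure \<mu> = ?\<rho>"
  proof (rule measure_eqI)
    fix A assume "A \<in> sets (spectral_measure \<mu>)"
    then have A [measurable]: "A \<in> sets borel" by simp
    have restrict: "density \<mu> (indicator (- {0})) = \<kappa>"
    proof (rule measure_eqI)
      fix X assume "X \<in> sets (density \<mu> (indicator (- {0})))"
      then have X [measurable]: "X \<in> sets borel" by simp
      have "emeasure (density \<mu> (indicator (- {0}))) X = emeasure \<mu> (X - {0})"
        by (subst emeasure_density) (auto simp: Diff_eq Int_commute simp flip: indicator_inter_arith)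
      also have "\<dots> = emeasure \<kappa> (X - {0})" by (simp add: em)
      also have "\<dots> = emeasure \<kappa> X"
        using \<kappa>_0 by (intro emeasure_Diff_null_set) (auto simp: null_sets_def)
      finally show "emeasure (density \<mu> (indicator (- {0}))) X = emeasure \<kappa> X" .
    qed simp
    have "emeasure (spectral_measure \<mu>) A = (\<integral>\<^sup>+x. indicator A x \<partial>spectral_measure \<mu>)" by simp
    also have "\<dots> = (\<integral>\<^sup>+t. ennreal (1 / t) * indicator A (1 / t - 1) \<partial>\<mu>)"
      by (rule nn_integral_spectral_measure) auto
    also have "\<dots> = (\<integral>\<^sup>+t. indicator (- {0}) t * (ennreal (1 / t) * indicator A (1 / t - 1)) \<partial>\<mu>)"
      by (intro nn_integral_cong) (auto simp: indicator_def)
    also have "\<dots> = (\<integral>\<^sup>+t. ennreal (1 / t) * indicator A (1 / t - 1) \<partial>density \<mu> (indicator (- {0})))"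
      by (subst nn_integral_density) auto
    also have "\<dots> = (\<integral>\<^sup>+x. ennreal (1 / (1 + x)) *
        (ennreal (1 / (1 / (1 + x))) * indicator A (1 / (1 / (1 + x)) - 1)) \<partial>?\<rho>)"
      unfolding restrict by (rule nn_\<kappa>) measurable
    also have "\<dots> = (\<integral>\<^sup>+x. indicator A x \<partial>?\<rho>)"
    proof (rule nn_integral_cong_AE)
      show "AE x in ?\<rho>. ennreal (1 / (1 + x)) *
          (ennreal (1 / (1 / (1 + x))) * indicator A (1 / (1 / (1 + x)) - 1)) = indicator A x"
        using nonneg
      proof eventually_elim
        case (elim x)
        have "ennreal (1 / (1 + x)) * ennreal (1 + x) = ennreal (1 / (1 + x) * (1 + x))"
          using elim by (intro ennreal_mult'[symmetric]) simp
        also have "\<dots> = 1" using elim by simp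
        finally show ?case by (simp add: indicator_def del: ennreal_plus)
      qed
    qed
    also have "\<dots> = emeasure ?\<rho> A" by simp
    finally show "emeasure (spectral_measure \<mu>) A = emeasure ?\<rho> A" .
  qed simp
  ultimately show ?thesis by blast
qed

section \<open>Functions of the class as transforms of measures on the unit interval\<close>

lemma spectral_function_inj:
  assumes "spectral_function \<sigma>" "spectral_function \<tau>" "interval_measure \<sigma> = interval_measure \<tau>"
  shows "\<sigma> = \<tau>"
proof
  have val: "0 \<le> f x" "ennreal (f x) = emeasure (interval_measure f) {-1<..x}"
    if "spectral_function f" "0 \<le> x" for f x
  proof -
    have f: "mono f" "\<And>x. continuous (at_right x) f" "f (-1) = 0"
      using that(1) by (auto simp: spectral_function_def)
    show "0 \<le> f x" using monoD[OF f(1), of "-1" x] f(3) that(2) by simp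
    show "ennreal (f x) = emeasure (interval_measure f) {-1<..x}"
      using that(2) f by (subst emeasure_interval_measure_Ioc) (auto dest: monoD)
  qed
  fix x
  show "\<sigma> x = \<tau> x"
  proof (cases "x < 0")
    case False
    then have "ennreal (\<sigma> x) = ennreal (\<tau> x)" using val(2) assms by simp
    then show ?thesis using val(1) assms False by simp
  qed (use assms in \<open>simp add: spectral_function_def\<close>)
qed

definition stieltjes_fun :: "real measure \<Rightarrow> slit_fun" where
  "stieltjes_fun \<mu> = Some (\<lambda>z\<in>slit_plane. transform \<mu> z)"

text \<open>
  The pairs \<open>(c, \<sigma>)\<close> that represent a function other than \<open>\<infinity>\<close> are exactly those obtained from a measure
  on \<open>[0,1]\<close>. Together with the injectivity of \<open>stieltjes_fun\<close> this yields both the uniqueness of the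
  data and a description of the whole class.
\<close>

lemma represents_Some_iff:
  "represents c \<sigma> (Some f) \<longleftrightarrow> (\<exists>\<mu>. unit_measure \<mu> \<and> Some f = stieltjes_fun \<mu> \<and> c = emeasure \<mu> {0} \<and>
      spectral_function \<sigma> \<and> interval_measure \<sigma> = spectral_measure \<mu>)"
proof -
  have formula: "stieltjes_fun \<mu> = Some (\<lambda>z\<in>slit_plane. complex_of_real (enn2real (emeasure \<mu> {0})) +
      (LINT x:{0..}|spectral_measure \<mu>. 1 / (complex_of_real x - z)))" if "unit_measure \<mu>" for \<mu>
    unfolding stieltjes_fun_def option.inject
    by (intro restrict_ext) (simp only: unit_measure.transform_eq_spectral_integral[OF that] measure_def)
  have fin: "emeasure \<mu> {0} < \<infinity>" if "unit_measure \<mu>" for \<mu>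
    using finite_measure.emeasure_finite[of \<mu> "{0}"] that by (simp add: unit_measure_def less_top)
  show ?thesis
  proof
    assume L: "represents c \<sigma> (Some f)"
    then have "spectral_function \<sigma>" "c < \<infinity>" by (auto simp: represents_def)
    then obtain \<mu> where "unit_measure \<mu>" "emeasure \<mu> {0} = c" "spectral_measure \<mu> = interval_measure \<sigma>"
      using exists_unit_measure by blast
    then show "\<exists>\<mu>. unit_measure \<mu> \<and> Some f = stieltjes_fun \<mu> \<and> c = emeasure \<mu> {0} \<and>
        spectral_function \<sigma> \<and> interval_measure \<sigma> = spectral_measure \<mu>"
      using L formula by (intro exI[of _ \<mu>]) (simp add: represents_def)
  next
    assume "\<exists>\<mu>. unit_measure \<mu> \<and> Some f = stieltjes_fun \<mu> \<and> c = emeasure \<mu> {0} \<and>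
        spectral_function \<sigma> \<and> interval_measure \<sigma> = spectral_measure \<mu>"
    then show "represents c \<sigma> (Some f)"
      using fin by (auto simp: represents_def formula)
  qed
qed

lemma represents_None_iff: "represents c \<sigma> None \<longleftrightarrow> c = \<infinity> \<and> \<sigma> = (\<lambda>_. 0)"
  by (simp add: represents_def)

lemma stieltjes_fun_inj:
  assumes "unit_measure \<mu>" "unit_measure \<nu>" "stieltjes_fun \<mu> = stieltjes_fun \<nu>"
  shows "\<mu> = \<nu>"
proof (rule transform_inj[OF assms(1,2)])
  fix z :: complex assume "z \<in> slit_plane"
  then show "transform \<mu> z = transform \<nu> z"
    using assms(3) unfolding stieltjes_fun_def option.inject by (metis restrict_apply')
qed

lemma stieltjes_fun_in_WW: "unit_measure \<mu> \<Longrightarrow> stieltjes_fun \<mu> \<in> WW"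
  unfolding WW_def mem_Collect_eq
  using unit_measure.exists_spectral_function[of \<mu>] represents_Some_iff
  by (metis stieltjes_fun_def)

lemma principal_spectral_function_stieltjes_fun:
  assumes "unit_measure \<mu>"
  shows "interval_measure (principal_spectral_function (stieltjes_fun \<mu>)) = spectral_measure \<mu>"
proof -
  have iff: "(\<exists>c. represents c \<tau> (stieltjes_fun \<mu>)) \<longleftrightarrow>
      spectral_function \<tau> \<and> interval_measure \<tau> = spectral_measure \<mu>" for \<tau>
    using assms stieltjes_fun_inj represents_Some_iff by (metis stieltjes_fun_def)
  obtain \<sigma> where \<sigma>: "spectral_function \<sigma>" "interval_measure \<sigma> = spectral_measure \<mu>"
    using unit_measure.exists_spectral_function[OF assms] by blast
  have "principal_spectral_function (stieltjes_fun \<mu>) = \<sigma>"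
    unfolding principal_spectral_function_def iff
    by (rule the_equality) (use \<sigma> spectral_function_inj in auto)
  with \<sigma> show ?thesis by simp
qed

text \<open>
  The functions \<open>0\<close> and \<open>\<infinity>\<close> are treated apart. As both of them have spectral function \<open>0\<close>, their spectral
  measures are written as the spectral measure of the zero measure, and all moment conditions hold.
\<close>

abbreviation zero_fun :: slit_fun where
  "zero_fun \<equiv> Some (\<lambda>z\<in>slit_plane. 0)"

abbreviation null_borel :: "real measure" where
  "null_borel \<equiv> null_measure borel"

lemma unit_measure_null_borel: "unit_measure null_borel"
  by (intro unit_measure.intro unit_measure_axioms.intro finite_measureI)
     (auto simp: AE_iff_null null_sets_def)

lemma stieltjes_fun_null_borel: "stieltjes_fun null_borel = zero_fun"
  by (simp add: stieltjes_fun_def transform_def)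

lemma interval_measure_zero: "interval_measure (\<lambda>_. 0) = spectral_measure null_borel"
proof -
  obtain \<sigma> where \<sigma>: "spectral_function \<sigma>" "interval_measure \<sigma> = spectral_measure null_borel"
    using unit_measure.exists_spectral_function[OF unit_measure_null_borel] by blast
  have "\<sigma> x = 0" for x
  proof (cases "x < 0")
    case False
    have "\<sigma> (-1) = 0" "\<sigma> (-1) \<le> \<sigma> x"
      using \<sigma>(1) False monoD[of \<sigma> "-1" x] by (auto simp: spectral_function_def)
    moreover have "emeasure (interval_measure \<sigma>) {-1<..x} = ennreal (\<sigma> x - \<sigma> (-1))"
      using \<sigma>(1) False
      by (intro emeasure_interval_measure_Ioc) (auto simp: spectral_function_def mono_def)
    moreover have "emeasure (spectral_measure null_borel) {-1<..x} = 0"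
      using nn_integral_spectral_measure[of null_borel "indicator {-1<..x}"] by simp
    ultimately show ?thesis using \<sigma>(2) by (simp add: ennreal_eq_0_iff)
  qed (use \<sigma>(1) in \<open>simp add: spectral_function_def\<close>)
  then have "\<sigma> = (\<lambda>_. 0)" by auto
  with \<sigma>(2) show ?thesis by simp
qed

lemma principal_spectral_function_None: "principal_spectral_function None = (\<lambda>_. 0)"
  unfolding principal_spectral_function_def represents_None_iff by simp

text \<open>
  A nonzero measure has positive mass, hence a dual measure; only the degenerate functions are left.
\<close>

lemma WW_cases:
  assumes "W \<in> WW"
  obtains "W = None" | "W = zero_fun" | \<mu> \<nu> where "dual_pair \<mu> \<nu>" "W = stieltjes_fun \<mu>"
proof (cases W)
  case (Some f)
  with assms obtain \<mu> where \<mu>: "unit_measure \<mu>" "W = stieltjes_fun \<mu>"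
    by (auto simp: WW_def represents_Some_iff)
  interpret unit_measure \<mu> by fact
  show ?thesis
  proof (cases "measure \<mu> UNIV = 0")
    case True
    have "\<mu> = null_borel"
    proof (rule measure_eqI)
      fix A
      have "emeasure \<mu> A \<le> emeasure \<mu> UNIV" by (rule emeasure_mono) auto
      then show "emeasure \<mu> A = emeasure null_borel A" using True by (simp add: emeasure_eq_measure)
    qed simp
    then show ?thesis using that(2) \<mu>(2) stieltjes_fun_null_borel by simp
  next
    case False
    then have "0 < measure \<mu> UNIV" by (simp add: zero_less_measure_iff)
    then show ?thesis using exists_dual_pair that(3) \<mu>(2) by blast
  qed
qed (use that in auto)

lemma dual_stieltjes_fun:
  assumes "dual_pair \<mu> \<nu>"
  shows "dual (stieltjes_fun \<mu>) = stieltjes_fun \<nu>"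
proof -
  have eq: "- z * transform \<mu> z * transform \<nu> z = 1" if "z \<in> slit_plane" for z
    using assms that by (simp add: dual_pair_def)
  have nz: "transform \<mu> (-1) \<noteq> 0" using eq[of "-1"] by auto
  have "(\<lambda>z\<in>slit_plane. transform \<mu> z) \<noteq> (\<lambda>z\<in>slit_plane. 0)"
  proof
    assume "(\<lambda>z\<in>slit_plane. transform \<mu> z) = (\<lambda>z\<in>slit_plane. 0)"
    then have "(\<lambda>z\<in>slit_plane. transform \<mu> z) (-1) = (\<lambda>z\<in>slit_plane. 0) (-1)" by simp
    then show False using nz by simp
  qed
  moreover have "1 / (- z * transform \<mu> z) = transform \<nu> z" if "z \<in> slit_plane" for z
  proof -
    have "- z * transform \<mu> z \<noteq> 0" using eq[OF that] by auto
    then show ?thesis using eq[OF that] by (metis nonzero_divide_eq_eq mult.commute)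
  qed
  ultimately show ?thesis
    by (auto simp: dual_def stieltjes_fun_def intro!: restrict_ext)
qed

lemma minus_transform_stieltjes_fun:
  assumes "dual_pair \<mu> \<nu>"
  shows "minus_transform (stieltjes_fun \<mu>) = stieltjes_fun (reflect \<nu>)"
proof -
  have \<nu>: "unit_measure \<nu>" using assms by (simp add: dual_pair_def)
  have "minus_transform (stieltjes_fun \<mu>) =
      Some (\<lambda>z\<in>slit_plane. 1 / (- z) * (\<lambda>z\<in>slit_plane. transform \<nu> z) (1 / z))"
    unfolding minus_transform_def dual_stieltjes_fun[OF assms] by (simp add: stieltjes_fun_def)
  also have "\<dots> = stieltjes_fun (reflect \<nu>)"
    unfolding stieltjes_fun_def option.inject
    by (intro restrict_ext)
       (simp only: unit_measure.transform_reflect[OF \<nu>] restrict_apply' inverse_slit_plane)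
  finally show ?thesis .
qed

lemma minus_transform_zero_fun: "minus_transform zero_fun = None"
  by (simp add: minus_transform_def dual_def)

lemma minus_transform_None: "minus_transform None = zero_fun"
  by (auto simp: minus_transform_def dual_def inverse_slit_plane[simplified] intro!: restrict_ext)

section \<open>Moments and the characterization of the class\<close>

text \<open>
  On \<open>(0,1)\<close> both integrands become \<open>(1/t) ((1 - t)/t)\<^sup>n\<close>. The index shift by one stems from the two
  densities: \<open>1/t\<close> for \<open>\<mu>\<close> and \<open>1/(1 - t)\<close> for the reflected measure. The endpoints contribute nothing
  on either side.
\<close>

lemma moment_reflect:
  assumes \<mu>: "unit_measure \<mu>"
  shows "(\<integral>\<^sup>+x\<in>{0<..}. ennreal (1 / x ^ Suc n) \<partial>spectral_measure (reflect \<mu>)) =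
    (\<integral>\<^sup>+x\<in>{0<..}. ennreal (x ^ n) \<partial>spectral_measure \<mu>)"
proof -
  interpret unit_measure \<mu> by fact
  have "(\<integral>\<^sup>+x\<in>{0<..}. ennreal (1 / x ^ Suc n) \<partial>spectral_measure (reflect \<mu>)) =
      (\<integral>\<^sup>+s. ennreal (1 / s) * (ennreal (1 / (1 / s - 1) ^ Suc n) * indicator {0<..} (1 / s - 1)) \<partial>reflect \<mu>)"
    by (rule nn_integral_spectral_measure) (auto simp: reflect_def)
  also have "\<dots> = (\<integral>\<^sup>+t. ennreal (1 / (1 - t)) *
      (ennreal (1 / (1 / (1 - t) - 1) ^ Suc n) * indicator {0<..} (1 / (1 - t) - 1)) \<partial>\<mu>)"
    unfolding reflect_def by (subst nn_integral_distr) auto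
  also have "\<dots> = (\<integral>\<^sup>+t. ennreal (1 / t) * (ennreal ((1 / t - 1) ^ n) * indicator {0<..} (1 / t - 1)) \<partial>\<mu>)"
  proof (rule nn_integral_cong_AE)
    show "AE t in \<mu>. ennreal (1 / (1 - t)) *
        (ennreal (1 / (1 / (1 - t) - 1) ^ Suc n) * indicator {0<..} (1 / (1 - t) - 1)) =
        ennreal (1 / t) * (ennreal ((1 / t - 1) ^ n) * indicator {0<..} (1 / t - 1))"
      using unit_supported
    proof eventually_elim
      case (elim t)
      show ?case
      proof (cases "t = 0 \<or> t = 1")
        case False
        then have t: "0 < t" "t < 1" using elim by auto
        have a: "1 / (1 - t) - 1 = t / (1 - t)" and b: "1 / t - 1 = (1 - t) / t"
          using t by (auto simp: field_simps)
        have "1 / (1 - t) * (1 / (t / (1 - t)) ^ Suc n) = 1 / t * ((1 - t) / t) ^ n"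
          using t by (simp add: power_divide)
        then have "ennreal (1 / (1 - t)) * ennreal (1 / (t / (1 - t)) ^ Suc n) =
            ennreal (1 / t) * ennreal (((1 - t) / t) ^ n)"
          using t by (simp only: ennreal_mult'[symmetric] less_imp_le divide_nonneg_nonneg
              zero_le_one diff_ge_0_iff_ge)
        then show ?thesis using t unfolding a b by simp
      qed auto
    qed
  qed
  also have "\<dots> = (\<integral>\<^sup>+x\<in>{0<..}. ennreal (x ^ n) \<partial>spectral_measure \<mu>)"
    by (rule nn_integral_spectral_measure[symmetric]) auto
  finally show ?thesis .
qed

definition finite_moments :: "real measure \<Rightarrow> bool" where
  "finite_moments \<rho> \<longleftrightarrow> (\<forall>n::nat. (\<integral>\<^sup>+x\<in>{0<..}. ennreal (x ^ n) \<partial>\<rho>) < \<infinity>)"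

definition finite_inverse_moments :: "real measure \<Rightarrow> bool" where
  "finite_inverse_moments \<rho> \<longleftrightarrow>
     (\<forall>n::nat. n \<ge> 1 \<longrightarrow> (\<integral>\<^sup>+x\<in>{0<..}. ennreal (1 / x ^ n) \<partial>\<rho>) < \<infinity>)"

lemma finite_inverse_moments_reflect:
  assumes "unit_measure \<mu>"
  shows "finite_inverse_moments (spectral_measure (reflect \<mu>)) \<longleftrightarrow> finite_moments (spectral_measure \<mu>)"
proof -
  have "(\<forall>n::nat. n \<ge> 1 \<longrightarrow> P n) \<longleftrightarrow> (\<forall>n. P (Suc n))" for P :: "nat \<Rightarrow> bool"
    by (metis Suc_le_D One_nat_def Suc_le_mono le0)
  then show ?thesis
    unfolding finite_inverse_moments_def finite_moments_def moment_reflect[OF assms, symmetric] by simp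
qed

lemma finite_moments_null:
  "finite_moments (spectral_measure null_borel)" "finite_inverse_moments (spectral_measure null_borel)"
  by (simp_all add: finite_moments_def finite_inverse_moments_def nn_integral_spectral_measure)

lemma WW_plus_iff:
  "W \<in> WW_plus \<longleftrightarrow> W \<in> WW \<and> finite_moments (interval_measure (principal_spectral_function W))"
  by (simp add: WW_plus_def finite_moments_def)

theorem theorem1:
  shows "WW_minus =
    {W \<in> WW. \<forall>n::nat. n \<ge> 1 \<longrightarrow>
       (\<integral>\<^sup>+x\<in>{0<..}. ennreal (1 / x ^ n)
          \<partial>interval_measure (principal_spectral_function (dual W))) < \<infinity>}"
proof -
  let ?R = "{W \<in> WW. finite_inverse_moments (interval_measure (principal_spectral_function (dual W)))}"
  have None_WW: "None \<in> WW" by (auto simp: WW_def represents_None_iff)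
  have zero_WW: "zero_fun \<in> WW"
    using stieltjes_fun_in_WW[OF unit_measure_null_borel] by (simp add: stieltjes_fun_null_borel)
  have psf_zero: "interval_measure (principal_spectral_function zero_fun) = spectral_measure null_borel"
    using principal_spectral_function_stieltjes_fun[OF unit_measure_null_borel]
    by (simp add: stieltjes_fun_null_borel)
  have psf_None: "interval_measure (principal_spectral_function None) = spectral_measure null_borel"
    by (simp add: principal_spectral_function_None interval_measure_zero)
  have dual_None: "dual None = zero_fun" and dual_zero: "dual zero_fun = None"
    by (simp_all add: dual_def)
  have None_R: "None \<in> ?R" and zero_R: "zero_fun \<in> ?R"
    using None_WW zero_WW by (simp_all add: dual_None dual_zero psf_zero psf_None finite_moments_null)
  have None_plus: "None \<in> WW_plus" and zero_plus: "zero_fun \<in> WW_plus"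
    using None_WW zero_WW by (simp_all add: WW_plus_iff psf_zero psf_None finite_moments_null)
  have minusI: "minus_transform W \<in> WW_minus" if "W \<in> WW_plus" for W
    using that by (auto simp: WW_minus_def)
  have "WW_minus = ?R"
  proof (intro equalityI subsetI)
    fix V assume "V \<in> WW_minus"
    then obtain W where W: "W \<in> WW_plus" "V = minus_transform W" by (auto simp: WW_minus_def)
    from W(1) have "W \<in> WW" by (simp add: WW_plus_iff)
    then show "V \<in> ?R"
    proof (cases rule: WW_cases)
      case 1
      then show ?thesis using W(2) zero_R by (simp only: minus_transform_None)
    next
      case 2
      then show ?thesis using W(2) None_R by (simp only: minus_transform_zero_fun)
    next
      case (3 \<mu> \<nu>)
      have \<mu>: "unit_measure \<mu>" using 3(1) by (simp add: dual_pair_def)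
      have refl: "dual_pair (reflect \<nu>) (reflect \<mu>)"
        by (rule dual_pair_commute[OF dual_pair_reflect[OF 3(1)]])
      have V: "V = stieltjes_fun (reflect \<nu>)"
        using W(2) 3(2) minus_transform_stieltjes_fun[OF 3(1)] by simp
      have "finite_moments (spectral_measure \<mu>)"
        using W(1) 3(2) principal_spectral_function_stieltjes_fun[OF \<mu>] by (simp add: WW_plus_iff)
      then show ?thesis
        using refl finite_inverse_moments_reflect[OF \<mu>]
        by (simp add: V dual_stieltjes_fun[OF refl] dual_pair_def stieltjes_fun_in_WW
            principal_spectral_function_stieltjes_fun)
    qed
  next
    fix V assume V: "V \<in> ?R"
    then have "V \<in> WW" by simp
    then show "V \<in> WW_minus"
    proof (cases rule: WW_cases)
      case 1
      then show ?thesis using minusI[OF zero_plus] by (simp only: minus_transform_zero_fun)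
    next
      case 2
      then show ?thesis using minusI[OF None_plus] by (simp only: minus_transform_None)
    next
      case (3 \<mu> \<nu>)
      have \<mu>: "unit_measure \<mu>" and \<nu>: "unit_measure \<nu>" using 3(1) by (simp_all add: dual_pair_def)
      have refl: "dual_pair (reflect \<nu>) (reflect \<mu>)"
        by (rule dual_pair_commute[OF dual_pair_reflect[OF 3(1)]])
      then have \<nu>': "unit_measure (reflect \<nu>)" by (simp add: dual_pair_def)
      have "finite_inverse_moments (spectral_measure \<nu>)"
        using V 3 by (simp add: dual_stieltjes_fun[OF 3(1)] principal_spectral_function_stieltjes_fun[OF \<nu>])
      then have "finite_moments (spectral_measure (reflect \<nu>))"
        using finite_inverse_moments_reflect[OF \<nu>'] by (simp add: unit_measure.reflect_reflect[OF \<nu>])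
      then have "stieltjes_fun (reflect \<nu>) \<in> WW_plus"
        using \<nu>' by (simp add: WW_plus_iff stieltjes_fun_in_WW principal_spectral_function_stieltjes_fun)
      from minusI[OF this] show ?thesis
        using 3(2) by (simp add: minus_transform_stieltjes_fun[OF refl] unit_measure.reflect_reflect[OF \<mu>])
    qed
  qed
  then show ?thesis by (simp add: finite_inverse_moments_def)
qed

end
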